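(* Let $\pi$ be a probability distribution on $\{0,1,2,\dots\}$ with mean $0<m(\pi)<1$. Then the $F$-probability of the Typically rooted Galton-Watson Tree $TGWT(\pi)$, where $F$ is the parent vertex-shift, is the Size-Biased Galton-Watson Tree $SBGW(\pi)$. That is, if $[\mathbf{T},\mathbf{o}]\sim TGWT(\pi)$, then $[\mathbf{T},F^n(\mathbf{o})]$ converges in distribution to $SBGW(\pi)$ as $n\to\infty$.
   Context: **Family Trees.** A Family Tree is a locally finite directed tree in which each vertex has out-degree at most $1$; $F(v)$ is the parent of $v$ (endpoint of its outgoing edge) if it exists, and $F(v)=v$ otherwise. It is ordered if the children of each vertex are totally ordered. Rooted (ordered) Family Trees are considered up to isomorphism, with the local topology (convergence means that balls of each radius around the root are eventually isomorphic). **$TGWT(\pi)$.** Let $\hat\pi(k)=k\pi(k)/m(\pi)$. $TGWT(\pi)$ is the random rooted ordered Family Tree $[\mathbf{T},\mathbf{o}]$ built as follows. (1) Add a parent to $\mathbf{o}$ with probability $m(\pi)$; iterate independently for that parent and all further ancestors, so the number $N$ of ancestors satisfies $\mathbb{P}[N=n]=m(\pi)^n(1-m(\pi))$, $n\geq 0$. (2) To each ancestor of $\mathbf{o}$, independently, attach $Z-1$ additional children, where $Z\sim\hat\pi$. (3) To each of these new children and to $\mathbf{o}$, attach independent ordered Galton-Watson trees with offspring distribution $\pi$. The order among the children of every vertex is uniform, independently. **$SBGW(\pi)$.** If $[\mathbf{T}',\mathbf{o}']$ is a Galton-Watson tree with offspring distribution $\pi$ rooted at its progenitor, $SBGW(\pi)$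 is the law $A\mapsto \mathbb{E}\big[\#V(\mathbf{T}')\,\mathbf{1}_A([\mathbf{T}',\mathbf{o}'])\big]/\mathbb{E}[\#V(\mathbf{T}')]$. *)

theory Defs
  imports "HOL-Probability.Probability" "HOL-Combinatorics.Multiset_Permutations"
begin

section \<open>Rooted ordered Family Trees\<close>

text \<open>
  An edge \<open>(u, v)\<close> points from \<open>u\<close> to its parent \<open>v\<close>; \<open>(u, v) \<in> older T\<close> says that \<open>u\<close> and \<open>v\<close>
  are siblings and that \<open>u\<close> precedes \<open>v\<close> in the order of the children of their parent.
\<close>

record 'v rtree =
  verts :: "'v set"
  edges :: "('v \<times> 'v) set"
  older :: "('v \<times> 'v) set"
  root :: 'v

definition adj :: "'v rtree \<Rightarrow> ('v \<times> 'v) set" where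
  "adj T = edges T \<union> (edges T)\<inverse>"

definition children :: "'v rtree \<Rightarrow> 'v \<Rightarrow> 'v set" where
  "children T v = {u. (u, v) \<in> edges T}"

definition undirected_cycle :: "'v rtree \<Rightarrow> 'v list \<Rightarrow> bool" where
  "undirected_cycle T xs \<longleftrightarrow>
     3 \<le> length xs \<and> distinct xs \<and>
     (\<forall>i < length xs. (xs ! i, xs ! (Suc i mod length xs)) \<in> adj T)"

text \<open>Asymmetry of the edge relation excludes loops and pairs of antiparallel edges.\<close>

definition directed_tree :: "'v rtree \<Rightarrow> bool" where
  "directed_tree T \<longleftrightarrow>
     edges T \<subseteq> verts T \<times> verts T \<and> asym (edges T) \<and>
     (\<forall>u \<in> verts T. \<forall>v \<in> verts T. (u, v) \<in> (adj T)\<^sup>*) \<and>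
     (\<nexists>xs. undirected_cycle T xs)"

definition rooted_ordered_family_tree :: "'v rtree \<Rightarrow> bool" where
  "rooted_ordered_family_tree T \<longleftrightarrow>
     directed_tree T \<and>
     (\<forall>v \<in> verts T. finite {u. (v, u) \<in> adj T}) \<and>
     single_valued (edges T) \<and>
     older T \<subseteq> (\<Union>v \<in> verts T. children T v \<times> children T v) \<and>
     (\<forall>v \<in> verts T.
        strict_linear_order_on (children T v) (older T \<inter> children T v \<times> children T v)) \<and>
     root T \<in> verts T"

definition parent_of :: "'v rtree \<Rightarrow> 'v \<Rightarrow> 'v" where
  "parent_of T v = (if \<exists>w. (v, w) \<in> edges T then (THE w. (v, w) \<in> edges T) else v)"

definition is_isomorphism :: "('v \<Rightarrow> 'w) \<Rightarrow> 'v rtree \<Rightarrow> 'w rtree \<Rightarrow> bool" where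
  "is_isomorphism f S T \<longleftrightarrow>
     bij_betw f (verts S) (verts T) \<and> f (root S) = root T \<and>
     (\<forall>u \<in> verts S. \<forall>v \<in> verts S. (u, v) \<in> edges S \<longleftrightarrow> (f u, f v) \<in> edges T) \<and>
     (\<forall>u \<in> verts S. \<forall>v \<in> verts S. (u, v) \<in> older S \<longleftrightarrow> (f u, f v) \<in> older T)"

definition isomorphic :: "'v rtree \<Rightarrow> 'w rtree \<Rightarrow> bool" where
  "isomorphic S T \<longleftrightarrow> (\<exists>f. is_isomorphism f S T)"

definition ball_verts :: "nat \<Rightarrow> 'v rtree \<Rightarrow> 'v set" where
  "ball_verts r T = {v \<in> verts T. \<exists>k \<le> r. (root T, v) \<in> adj T ^^ k}"

definition tree_ball :: "nat \<Rightarrow> 'v rtree \<Rightarrow> 'v rtree" where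
  "tree_ball r T =
     \<lparr>verts = ball_verts r T,
      edges = edges T \<inter> ball_verts r T \<times> ball_verts r T,
      older = older T \<inter> ball_verts r T \<times> ball_verts r T,
      root = root T\<rparr>"


subsection \<open>Basic facts\<close>

lemma is_isomorphism_refl: "is_isomorphism id T T"
  by (auto simp: is_isomorphism_def)

lemma is_isomorphism_sym:
  assumes "is_isomorphism f S T" "root S \<in> verts S"
  shows "is_isomorphism (inv_into (verts S) f) T S"
proof -
  let ?g = "inv_into (verts S) f"
  have b: "bij_betw f (verts S) (verts T)" using assms by (auto simp: is_isomorphism_def)
  have g: "?g v \<in> verts S" "f (?g v) = v" if "v \<in> verts T" for v
    using that b by (auto simp: bij_betw_def inv_into_into f_inv_into_f)
  show ?thesis
    unfolding is_isomorphism_def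
  proof (intro conjI ballI)
    show "bij_betw ?g (verts T) (verts S)" using b by (rule bij_betw_inv_into)
    show "?g (root T) = root S"
      using assms b by (metis bij_betw_inv_into_left is_isomorphism_def)
  qed (use assms(1) g in \<open>auto simp: is_isomorphism_def\<close>)
qed

lemma is_isomorphism_trans:
  assumes "is_isomorphism f S T" "is_isomorphism g T U"
  shows "is_isomorphism (g \<circ> f) S U"
proof -
  have m: "f u \<in> verts T" if "u \<in> verts S" for u
    using assms(1) that by (auto simp: is_isomorphism_def bij_betw_def)
  show ?thesis
    using assms m by (auto simp: is_isomorphism_def intro: bij_betw_trans)
qed

lemma is_isomorphism_verts: "is_isomorphism f S T \<Longrightarrow> u \<in> verts S \<Longrightarrow> f u \<in> verts T"
  by (auto simp: is_isomorphism_def bij_betw_def)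

lemma is_isomorphism_edges:
  "is_isomorphism f S T \<Longrightarrow> u \<in> verts S \<Longrightarrow> v \<in> verts S \<Longrightarrow> (f u, f v) \<in> edges T \<longleftrightarrow> (u, v) \<in> edges S"
  by (auto simp: is_isomorphism_def)

lemma is_isomorphism_adj:
  "is_isomorphism f S T \<Longrightarrow> u \<in> verts S \<Longrightarrow> v \<in> verts S \<Longrightarrow> (f u, f v) \<in> adj T \<longleftrightarrow> (u, v) \<in> adj S"
  by (auto simp: is_isomorphism_def adj_def)

lemma ball_verts_subset: "ball_verts r T \<subseteq> verts T"
  by (auto simp: ball_verts_def)

lemma ball_verts_mono: "s \<le> r \<Longrightarrow> ball_verts s T \<subseteq> ball_verts r T"
  unfolding ball_verts_def by (blast intro: order_trans)

lemma tree_ball_simps [simp]: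
  "verts (tree_ball r T) = ball_verts r T"
  "edges (tree_ball r T) = edges T \<inter> ball_verts r T \<times> ball_verts r T"
  "older (tree_ball r T) = older T \<inter> ball_verts r T \<times> ball_verts r T"
  "root (tree_ball r T) = root T"
  by (simp_all add: tree_ball_def)

lemma adj_tree_ball: "adj (tree_ball r T) = adj T \<inter> ball_verts r T \<times> ball_verts r T"
  by (auto simp: adj_def)

lemma root_in_ball: "root T \<in> verts T \<Longrightarrow> root T \<in> ball_verts r T"
  by (auto simp: ball_verts_def intro!: exI[of _ 0])

lemma adj_subset: "edges T \<subseteq> verts T \<times> verts T \<Longrightarrow> adj T \<subseteq> verts T \<times> verts T"
  by (auto simp: adj_def)

lemma is_isomorphism_tree_ball_relpow:
  assumes f: "is_isomorphism f (tree_ball r S) (tree_ball r T)"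
    and E: "edges S \<subseteq> verts S \<times> verts S" and r: "root S \<in> verts S"
  shows "k \<le> r \<Longrightarrow> (root S, v) \<in> adj S ^^ k \<Longrightarrow> (root T, f v) \<in> adj T ^^ k"
proof (induction k arbitrary: v)
  case 0
  then show ?case using f by (auto simp: is_isomorphism_def)
next
  case (Suc k)
  then obtain w where w: "(root S, w) \<in> adj S ^^ k" "(w, v) \<in> adj S" by auto
  have wv: "w \<in> verts S" "v \<in> verts S" using w(2) adj_subset[OF E] by auto
  have wB: "w \<in> ball_verts r S" "v \<in> ball_verts r S"
    using w wv Suc.prems Suc_leD unfolding ball_verts_def by blast+
  have "(f w, f v) \<in> adj T"
    using is_isomorphism_adj[OF f, of w v] wB w(2) by (auto simp: adj_tree_ball)
  then show ?case using Suc.IH[of w] Suc.prems(1) w(1) by auto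
qed

lemma is_isomorphism_tree_ball_mono:
  assumes f: "is_isomorphism f (tree_ball r S) (tree_ball r T)"
    and S: "edges S \<subseteq> verts S \<times> verts S" "root S \<in> verts S"
    and T: "edges T \<subseteq> verts T \<times> verts T" "root T \<in> verts T"
    and le: "s \<le> r"
  shows "is_isomorphism f (tree_ball s S) (tree_ball s T)"
proof -
  let ?g = "inv_into (ball_verts r S) f"
  have g: "is_isomorphism ?g (tree_ball r T) (tree_ball r S)"
    using is_isomorphism_sym[OF f] S(2) by (simp add: root_in_ball)
  have b: "bij_betw f (ball_verts r S) (ball_verts r T)"
    using f by (auto simp: is_isomorphism_def)
  note sub = ball_verts_mono[OF le]
  have 1: "f v \<in> ball_verts s T" if vs: "v \<in> ball_verts s S" for v
  proof -
    obtain k where k: "k \<le> s" "(root S, v) \<in> adj S ^^ k" using vs unfolding ball_verts_def by blast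
    have "(root T, f v) \<in> adj T ^^ k"
      using is_isomorphism_tree_ball_relpow[OF f S, of k v] k le by auto
    moreover have "f v \<in> verts T"
      using is_isomorphism_verts[OF f, of v] that sub[of S] ball_verts_subset[of r T] by auto
    ultimately show ?thesis using k by (auto simp: ball_verts_def)
  qed
  have 2: "?g v \<in> ball_verts s S" "f (?g v) = v" if vs: "v \<in> ball_verts s T" for v
  proof -
    have vr: "v \<in> ball_verts r T" using that sub[of T] by auto
    obtain k where k: "k \<le> s" "(root T, v) \<in> adj T ^^ k" using vs unfolding ball_verts_def by blast
    have "(root S, ?g v) \<in> adj S ^^ k"
      using is_isomorphism_tree_ball_relpow[OF g T, of k v] k le by auto
    moreover have "?g v \<in> verts S"
      using is_isomorphism_verts[OF g, of v] vr ball_verts_subset[of r S] by auto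
    ultimately show "?g v \<in> ball_verts s S" using k by (auto simp: ball_verts_def)
    show "f (?g v) = v" using vr b by (simp add: bij_betw_inv_into_right)
  qed
  have "bij_betw f (ball_verts s S) (ball_verts s T)"
    unfolding bij_betw_def
  proof
    show "inj_on f (ball_verts s S)" using b sub[of S] by (auto simp: bij_betw_def inj_on_subset)
    show "f ` ball_verts s S = ball_verts s T" using 1 2 by force
  qed
  then show ?thesis
    using f sub[of S] sub[of T] 1 by (auto simp: is_isomorphism_def subset_iff)
qed

lemma is_isomorphism_relpow:
  assumes f: "is_isomorphism f S T" and E: "edges S \<subseteq> verts S \<times> verts S"
  shows "(root S, v) \<in> adj S ^^ k \<Longrightarrow> (root T, f v) \<in> adj T ^^ k"
proof (induction k arbitrary: v)
  case 0
  then show ?case using f by (auto simp: is_isomorphism_def)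
next
  case (Suc k)
  then obtain w where w: "(root S, w) \<in> adj S ^^ k" "(w, v) \<in> adj S" by auto
  have "(f w, f v) \<in> adj T"
    using w(2) adj_subset[OF E] is_isomorphism_adj[OF f, of w v] by auto
  then show ?case using Suc.IH[OF w(1)] by auto
qed

lemma is_isomorphism_tree_ball:
  assumes f: "is_isomorphism f S T"
    and S: "edges S \<subseteq> verts S \<times> verts S" "root S \<in> verts S"
    and T: "edges T \<subseteq> verts T \<times> verts T" "root T \<in> verts T"
  shows "is_isomorphism f (tree_ball r S) (tree_ball r T)"
proof -
  let ?g = "inv_into (verts S) f"
  note g = is_isomorphism_sym[OF f S(2)]
  have b: "bij_betw f (verts S) (verts T)" using f by (auto simp: is_isomorphism_def)
  have 1: "f v \<in> ball_verts r T" if "v \<in> ball_verts r S" for v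
    using that is_isomorphism_relpow[OF f S(1), of v] is_isomorphism_verts[OF f, of v]
    by (auto simp: ball_verts_def)
  have 2: "?g v \<in> ball_verts r S" "f (?g v) = v" if "v \<in> ball_verts r T" for v
    using that is_isomorphism_relpow[OF g T(1), of v] is_isomorphism_verts[OF g, of v] b
    by (auto simp: ball_verts_def bij_betw_inv_into_right)
  have "bij_betw f (ball_verts r S) (ball_verts r T)"
    unfolding bij_betw_def
  proof
    show "inj_on f (ball_verts r S)"
      using b ball_verts_subset[of r S] by (auto simp: bij_betw_def inj_on_subset)
    show "f ` ball_verts r S = ball_verts r T" using 1 2 by force
  qed
  then show ?thesis
    using f ball_verts_subset[of r S] 1 by (auto simp: is_isomorphism_def subset_iff)
qed

lemma isomorphic_refl: "isomorphic T T"
  using is_isomorphism_refl by (auto simp: isomorphic_def)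

lemma isomorphic_sym: "isomorphic S T \<Longrightarrow> root S \<in> verts S \<Longrightarrow> isomorphic T S"
  using is_isomorphism_sym by (auto simp: isomorphic_def)

lemma isomorphic_trans: "isomorphic S T \<Longrightarrow> isomorphic T U \<Longrightarrow> isomorphic S U"
  using is_isomorphism_trans by (fastforce simp: isomorphic_def)

lemma family_treeD:
  assumes "rooted_ordered_family_tree T"
  shows "edges T \<subseteq> verts T \<times> verts T" "root T \<in> verts T" "single_valued (edges T)"
  using assms by (auto simp: rooted_ordered_family_tree_def directed_tree_def)

lemma parent_of_eq: "single_valued (edges T) \<Longrightarrow> (v, w) \<in> edges T \<Longrightarrow> parent_of T v = w"
  by (auto simp: parent_of_def single_valued_def intro!: the_equality)

lemma parent_of_in_verts:
  assumes "rooted_ordered_family_tree T" "v \<in> verts T"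
  shows "parent_of T v \<in> verts T"
proof (cases "\<exists>w. (v, w) \<in> edges T")
  case True
  then show ?thesis using family_treeD[OF assms(1)] parent_of_eq by fastforce
qed (use assms in \<open>auto simp: parent_of_def\<close>)

lemma ancestor_in_verts:
  assumes "rooted_ordered_family_tree T"
  shows "(parent_of T ^^ n) (root T) \<in> verts T"
  using assms by (induction n) (auto simp: parent_of_in_verts family_treeD)

lemma is_isomorphism_parent_of:
  assumes f: "is_isomorphism f S T"
    and S: "rooted_ordered_family_tree S" and T: "rooted_ordered_family_tree T"
    and v: "v \<in> verts S"
  shows "f (parent_of S v) = parent_of T (f v)"
proof (cases "\<exists>w. (v, w) \<in> edges S")
  case True
  then obtain w where w: "(v, w) \<in> edges S" by auto
  then have "w \<in> verts S" using family_treeD[OF S] by auto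
  then have "(f v, f w) \<in> edges T" using is_isomorphism_edges[OF f v] w by auto
  then show ?thesis using w family_treeD[OF S] family_treeD[OF T] parent_of_eq by metis
next
  case False
  have "\<nexists>w. (f v, w) \<in> edges T"
  proof
    assume "\<exists>w. (f v, w) \<in> edges T"
    then obtain w where w: "(f v, w) \<in> edges T" by auto
    then have "w \<in> verts T" using family_treeD[OF T] by auto
    then obtain u where "u \<in> verts S" "w = f u"
      using f unfolding is_isomorphism_def bij_betw_def by blast
    then show False using w False is_isomorphism_edges[OF f v] by auto
  qed
  then show ?thesis using False by (auto simp: parent_of_def)
qed

lemma is_isomorphism_ancestor:
  assumes f: "is_isomorphism f S T"
    and S: "rooted_ordered_family_tree S" and T: "rooted_ordered_family_tree T"
  shows "f ((parent_of S ^^ n) (root S)) = (parent_of T ^^ n) (root T)"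
proof (induction n)
  case 0
  then show ?case using f by (auto simp: is_isomorphism_def)
next
  case (Suc n)
  then show ?case using is_isomorphism_parent_of[OF f S T ancestor_in_verts[OF S]] by simp
qed

definition reroot :: "'v \<Rightarrow> 'v rtree \<Rightarrow> 'v rtree" where
  "reroot v T = T\<lparr>root := v\<rparr>"

lemma reroot_simps [simp]:
  "verts (reroot v T) = verts T" "edges (reroot v T) = edges T"
  "older (reroot v T) = older T" "root (reroot v T) = v"
  by (simp_all add: reroot_def)

lemma family_tree_reroot:
  "rooted_ordered_family_tree T \<Longrightarrow> v \<in> verts T \<Longrightarrow> rooted_ordered_family_tree (reroot v T)"
  by (simp add: rooted_ordered_family_tree_def directed_tree_def undirected_cycle_def adj_def
      children_def)


section \<open>The space of isomorphism classes and its local topology\<close>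

text \<open>
  A connected locally finite graph is countable, so every rooted ordered Family Tree is isomorphic
  to one whose vertices are finite sequences of natural numbers.
\<close>

definition family_tree_eq :: "nat list rtree \<Rightarrow> nat list rtree \<Rightarrow> bool" where
  "family_tree_eq S T \<longleftrightarrow>
     rooted_ordered_family_tree S \<and> rooted_ordered_family_tree T \<and> isomorphic S T"

lemma single_vertex_family_tree:
  "rooted_ordered_family_tree \<lparr>verts = {v}, edges = {}, older = {}, root = v\<rparr>"
proof -
  have "\<not> undirected_cycle \<lparr>verts = {v}, edges = {}, older = {}, root = v\<rparr> xs" for xs
    by (cases xs) (auto simp: undirected_cycle_def adj_def)
  then show ?thesis
    by (auto simp: rooted_ordered_family_tree_def directed_tree_def adj_def children_def asym_on_def
        strict_linear_order_on_def)
qed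

quotient_type family_tree = "nat list rtree" / partial: family_tree_eq
proof (rule part_equivpI)
  show "\<exists>x. family_tree_eq x x"
    using single_vertex_family_tree[of "[] :: nat list"] isomorphic_refl unfolding family_tree_eq_def
    by (intro exI[of _ "\<lparr>verts = {[]}, edges = {}, older = {}, root = []\<rparr>"]) simp
  show "symp family_tree_eq"
    by (auto simp: symp_def family_tree_eq_def intro: isomorphic_sym dest: family_treeD)
  show "transp family_tree_eq"
    by (auto simp: transp_def family_tree_eq_def intro: isomorphic_trans)
qed

abbreviation tree_class :: "nat list rtree \<Rightarrow> family_tree" where
  "tree_class \<equiv> abs_family_tree"

lift_definition ball_eq :: "nat \<Rightarrow> family_tree \<Rightarrow> family_tree \<Rightarrow> bool" is
  "\<lambda>r S T. isomorphic (tree_ball r S) (tree_ball r T)"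
proof -
  fix r and S S' T T' :: "nat list rtree"
  assume "family_tree_eq S S'" "family_tree_eq T T'"
  then have *: "isomorphic (tree_ball r S) (tree_ball r S')" "isomorphic (tree_ball r S') (tree_ball r S)"
    "isomorphic (tree_ball r T) (tree_ball r T')" "isomorphic (tree_ball r T') (tree_ball r T)"
    using isomorphic_sym is_isomorphism_tree_ball unfolding isomorphic_def family_tree_eq_def
    by (metis family_treeD(1,2) isomorphic_def)+
  show "isomorphic (tree_ball r S) (tree_ball r T) = isomorphic (tree_ball r S') (tree_ball r T')"
    using * isomorphic_trans by blast
qed

lemma ball_eq_refl: "ball_eq r t t"
  by transfer (rule isomorphic_refl)

lemma ball_eq_sym: "ball_eq r s t \<Longrightarrow> ball_eq r t s"
  by transfer (simp add: family_tree_eq_def root_in_ball family_treeD isomorphic_sym)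

lemma ball_eq_trans: "ball_eq r s t \<Longrightarrow> ball_eq r t u \<Longrightarrow> ball_eq r s u"
  by transfer (rule isomorphic_trans)

lemma ball_eq_mono: "ball_eq r s t \<Longrightarrow> q \<le> r \<Longrightarrow> ball_eq q s t"
  by transfer
    (metis family_tree_eq_def isomorphic_def is_isomorphism_tree_ball_mono family_treeD(1,2))

instantiation family_tree :: topological_space
begin

definition open_family_tree :: "family_tree set \<Rightarrow> bool" where
  "open_family_tree U \<longleftrightarrow> (\<forall>s \<in> U. \<exists>r. \<forall>t. ball_eq r s t \<longrightarrow> t \<in> U)"

instance
proof
  fix U V :: "family_tree set"
  assume UV: "open U" "open V"
  show "open (U \<inter> V)"
    unfolding open_family_tree_def
  proof
    fix s assume "s \<in> U \<inter> V"
    then obtain q r where "\<forall>t. ball_eq q s t \<longrightarrow> t \<in> U" "\<forall>t. ball_eq r s t \<longrightarrow> t \<in> V"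
      using UV unfolding open_family_tree_def by blast
    then have "\<forall>t. ball_eq (max q r) s t \<longrightarrow> t \<in> U \<inter> V"
      using ball_eq_mono[of "max q r" s] by auto
    then show "\<exists>r. \<forall>t. ball_eq r s t \<longrightarrow> t \<in> U \<inter> V" ..
  qed
next
  show "open (UNIV :: family_tree set)" by (simp add: open_family_tree_def)
next
  fix K :: "family_tree set set"
  assume "\<forall>U \<in> K. open U"
  then show "open (\<Union>K)" unfolding open_family_tree_def by (meson Union_iff)
qed

end

lemma open_ball_eq: "open {t. ball_eq r s t}"
  by (auto simp: open_family_tree_def intro: ball_eq_trans)

lemma tendsto_family_tree_iff:
  fixes X :: "nat \<Rightarrow> family_tree"
  shows "X \<longlonglongrightarrow> t \<longleftrightarrow> (\<forall>r. \<forall>\<^sub>F n in sequentially. ball_eq r t (X n))"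
proof
  assume "X \<longlonglongrightarrow> t"
  then show "\<forall>r. \<forall>\<^sub>F n in sequentially. ball_eq r t (X n)"
    using topological_tendstoD[OF _ open_ball_eq] ball_eq_refl by fastforce
next
  assume R: "\<forall>r. \<forall>\<^sub>F n in sequentially. ball_eq r t (X n)"
  show "X \<longlonglongrightarrow> t"
  proof (rule topological_tendstoI)
    fix U assume "open U" "t \<in> U"
    then obtain r where r: "\<forall>s. ball_eq r t s \<longrightarrow> s \<in> U" by (auto simp: open_family_tree_def)
    have "\<forall>\<^sub>F n in sequentially. ball_eq r t (X n)" using R ..
    then show "\<forall>\<^sub>F n in sequentially. X n \<in> U" by (rule eventually_mono) (use r in blast)
  qed
qed

text \<open>\<open>ancestor_shift n\<close> maps \<open>[T, v]\<close> to \<open>[T, F\<^sup>n(v)]\<close>, where \<open>F\<close> is the parent vertex-shift.\<close>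

lift_definition ancestor_shift :: "nat \<Rightarrow> family_tree \<Rightarrow> family_tree" is
  "\<lambda>n T. reroot ((parent_of T ^^ n) (root T)) T"
proof -
  fix n and S T :: "nat list rtree"
  assume "family_tree_eq S T"
  then obtain f where S: "rooted_ordered_family_tree S" and T: "rooted_ordered_family_tree T"
    and f: "is_isomorphism f S T" by (auto simp: family_tree_eq_def isomorphic_def)
  have "is_isomorphism f (reroot ((parent_of S ^^ n) (root S)) S) (reroot ((parent_of T ^^ n) (root T)) T)"
    using f is_isomorphism_ancestor[OF f S T, of n] by (auto simp: is_isomorphism_def)
  then show "family_tree_eq (reroot ((parent_of S ^^ n) (root S)) S) (reroot ((parent_of T ^^ n) (root T)) T)"
    using S T by (auto simp: family_tree_eq_def isomorphic_def ancestor_in_verts family_tree_reroot)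
qed

lift_definition num_verts :: "family_tree \<Rightarrow> ennreal" is
  "\<lambda>T. emeasure (count_space UNIV) (verts T)"
  by (auto simp: family_tree_eq_def isomorphic_def is_isomorphism_def emeasure_count_space
      dest: bij_betw_finite bij_betw_same_card)


section \<open>Random Family Trees\<close>

text \<open>
  Vertices are finite sequences of natural numbers and the parent of \<open>v @ [i]\<close> is \<open>v\<close>.
  The mark \<open>\<xi> v\<close> is a list of the labels of the children of \<open>v\<close>, sorted by the order among them
  (by first occurrence, if labels are repeated).
\<close>

inductive_set marked_tree_verts :: "(nat list \<Rightarrow> nat list) \<Rightarrow> nat list set"
  for \<xi> :: "nat list \<Rightarrow> nat list" where
  "[] \<in> marked_tree_verts \<xi>"
| "v \<in> marked_tree_verts \<xi> \<Longrightarrow> i \<in> set (\<xi> v) \<Longrightarrow> v @ [i] \<in> marked_tree_verts \<xi>"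

definition marked_tree :: "(nat list \<Rightarrow> nat list) \<Rightarrow> nat list \<Rightarrow> nat list rtree" where
  "marked_tree \<xi> w =
     \<lparr>verts = marked_tree_verts \<xi>,
      edges = {(v @ [i], v) | v i. v \<in> marked_tree_verts \<xi> \<and> i \<in> set (\<xi> v)},
      older = {(v @ [i], v @ [j]) | v i j. v \<in> marked_tree_verts \<xi> \<and>
                 j \<in> set (\<xi> v) \<and> i \<in> set (takeWhile (\<lambda>k. k \<noteq> j) (\<xi> v))},
      root = w\<rparr>"

lemma no_undirected_cycle_if_ranked:
  fixes rank :: "'v \<Rightarrow> nat"
  assumes sv: "single_valued (edges T)"
    and rank: "\<And>u v. (u, v) \<in> edges T \<Longrightarrow> rank v < rank u"
  shows "\<not> undirected_cycle T xs"
proof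
  assume c: "undirected_cycle T xs"
  let ?n = "length xs"
  have n: "3 \<le> ?n" and d: "distinct xs"
    and a: "\<And>i. i < ?n \<Longrightarrow> (xs ! i, xs ! (Suc i mod ?n)) \<in> adj T"
    using c by (auto simp: undirected_cycle_def)
  have "finite (rank ` set xs)" "rank ` set xs \<noteq> {}" using n by auto
  then have "Max (rank ` set xs) \<in> rank ` set xs" by (rule Max_in)
  then obtain i where i: "i < ?n" "rank (xs ! i) = Max (rank ` set xs)"
    by (auto simp: in_set_conv_nth)
  have mx: "rank (xs ! j) \<le> rank (xs ! i)" if "j < ?n" for j
    using that i by (auto intro!: Max_ge)
  define s where "s = (if Suc i = ?n then 0 else Suc i)"
  define p where "p = (if i = 0 then ?n - 1 else i - 1)"
  have sp: "s < ?n" "p < ?n" "s \<noteq> p" using i n by (auto simp: s_def p_def split: if_splits)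
  have "Suc i mod ?n = s" "Suc p mod ?n = i" using i n by (auto simp: s_def p_def)
  then have "(xs ! i, xs ! s) \<in> adj T" "(xs ! p, xs ! i) \<in> adj T"
    using a[OF i(1)] a[OF sp(2)] by auto
  then have "(xs ! i, xs ! s) \<in> edges T" "(xs ! i, xs ! p) \<in> edges T"
    using rank mx[OF sp(1)] mx[OF sp(2)] by (force simp: adj_def)+
  then have "xs ! s = xs ! p" using sv by (auto simp: single_valued_def)
  then show False using d sp by (simp add: nth_eq_iff_index_eq)
qed

lemma family_tree_marked_tree:
  assumes w: "w \<in> marked_tree_verts \<xi>"
  shows "rooted_ordered_family_tree (marked_tree \<xi> w)"
proof -
  let ?T = "marked_tree \<xi> w" and ?V = "marked_tree_verts \<xi>"
  have E: "edges ?T = {(v @ [i], v) | v i. v \<in> ?V \<and> i \<in> set (\<xi> v)}"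
    and V: "verts ?T = ?V" and root: "root ?T = w"
    and O: "older ?T = {(v @ [i], v @ [j]) | v i j. v \<in> ?V \<and>
                 j \<in> set (\<xi> v) \<and> i \<in> set (takeWhile (\<lambda>k. k \<noteq> j) (\<xi> v))}"
    by (simp_all add: marked_tree_def)
  have sub: "edges ?T \<subseteq> verts ?T \<times> verts ?T"
    unfolding E V by (auto intro: marked_tree_verts.intros)
  have sv: "single_valued (edges ?T)" unfolding E by (auto simp: single_valued_def)
  have rank: "length v < length u" if "(u, v) \<in> edges ?T" for u v using that unfolding E by auto
  have as: "asym (edges ?T)" by (rule asymI) (meson rank less_asym)
  have to_top: "(v, []) \<in> (adj ?T)\<^sup>*" if "v \<in> ?V" for v
    using that
  proof induction
    case (2 v i)
    then have "(v @ [i], v) \<in> adj ?T" unfolding adj_def E by auto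
    then show ?case using 2 by (meson converse_rtrancl_into_rtrancl)
  qed auto
  have symadj: "sym (adj ?T)" by (auto simp: sym_def adj_def)
  have conn: "(u, v) \<in> (adj ?T)\<^sup>*" if "u \<in> ?V" "v \<in> ?V" for u v
    using to_top[OF that(1)] to_top[OF that(2)] sym_rtrancl[OF symadj]
    by (meson rtrancl_trans symE)
  have fin: "finite {u. (v, u) \<in> adj ?T}" for v
  proof (rule finite_subset)
    show "{u. (v, u) \<in> adj ?T} \<subseteq> insert (butlast v) ((\<lambda>i. v @ [i]) ` set (\<xi> v))"
      unfolding adj_def E by auto
  qed auto
  have ch: "children ?T v = (\<lambda>i. v @ [i]) ` set (\<xi> v)" if "v \<in> ?V" for v
    using that unfolding children_def E by auto
  have tw: "i \<in> set xs \<and> i \<noteq> j" if "i \<in> set (takeWhile (\<lambda>k. k \<noteq> j) xs)" for i j :: nat and xs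
    using that by (auto dest: set_takeWhileD)
  have Osub: "older ?T \<subseteq> (\<Union>v \<in> verts ?T. children ?T v \<times> children ?T v)"
  proof
    fix e assume "e \<in> older ?T"
    then obtain v i j where e: "e = (v @ [i], v @ [j])" "v \<in> ?V" "j \<in> set (\<xi> v)"
      "i \<in> set (takeWhile (\<lambda>k. k \<noteq> j) (\<xi> v))" unfolding O by blast
    then have "e \<in> children ?T v \<times> children ?T v" using tw[OF e(4)] by (simp add: ch)
    then show "e \<in> (\<Union>v \<in> verts ?T. children ?T v \<times> children ?T v)" using e(2) V by blast
  qed
  have lin: "strict_linear_order_on (children ?T v) (older ?T \<inter> children ?T v \<times> children ?T v)"
    if v: "v \<in> ?V" for v
  proof -
    have eq: "older ?T \<inter> children ?T v \<times> children ?T v =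
      {(v @ [i], v @ [j]) | i j. j \<in> set (\<xi> v) \<and> i \<in> set (takeWhile (\<lambda>k. k \<noteq> j) (\<xi> v))}"
      (is "_ = ?R")
    proof
      show "older ?T \<inter> children ?T v \<times> children ?T v \<subseteq> ?R"
        unfolding O ch[OF v] by auto
      show "?R \<subseteq> older ?T \<inter> children ?T v \<times> children ?T v"
      proof
        fix e assume "e \<in> ?R"
        then obtain i j where e: "e = (v @ [i], v @ [j])" "j \<in> set (\<xi> v)"
          "i \<in> set (takeWhile (\<lambda>k. k \<noteq> j) (\<xi> v))" by blast
        then show "e \<in> older ?T \<inter> children ?T v \<times> children ?T v"
          unfolding O ch[OF v] using v tw[OF e(3)] by blast
      qed
    qed
    have tr: "i \<in> set (takeWhile (\<lambda>k. k \<noteq> l) xs)"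
      if "i \<in> set (takeWhile (\<lambda>k. k \<noteq> j) xs)" "j \<in> set (takeWhile (\<lambda>k. k \<noteq> l) xs)"
      for i j l :: nat and xs
      using that by (induction xs) (auto split: if_splits)
    have tot: "i \<in> set (takeWhile (\<lambda>k. k \<noteq> j) xs) \<or> j \<in> set (takeWhile (\<lambda>k. k \<noteq> i) xs)"
      if "i \<in> set xs" "j \<in> set xs" "i \<noteq> j" for i j :: nat and xs
      using that by (induction xs) auto
    show ?thesis
      unfolding eq unfolding strict_linear_order_on_def ch[OF v]
    proof (intro conjI)
      show "trans {(v @ [i], v @ [j]) | i j. j \<in> set (\<xi> v) \<and> i \<in> set (takeWhile (\<lambda>k. k \<noteq> j) (\<xi> v))}"
        using tr unfolding trans_def by blast
      show "irrefl {(v @ [i], v @ [j]) | i j. j \<in> set (\<xi> v) \<and> i \<in> set (takeWhile (\<lambda>k. k \<noteq> j) (\<xi> v))}"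
        by (auto simp: irrefl_def dest: set_takeWhileD)
      show "total_on ((\<lambda>i. v @ [i]) ` set (\<xi> v))
        {(v @ [i], v @ [j]) | i j. j \<in> set (\<xi> v) \<and> i \<in> set (takeWhile (\<lambda>k. k \<noteq> j) (\<xi> v))}"
        using tot by (fastforce simp: total_on_def)
    qed
  qed
  show ?thesis
    unfolding rooted_ordered_family_tree_def directed_tree_def
    using sub sv as conn fin Osub lin w no_undirected_cycle_if_ranked[OF sv rank]
    by (auto simp: V root)
qed

text \<open>
  If \<open>n \<mapsto> n \<cdot> pmf \<pi> n\<close> is not summable, then the expectation is 0 by convention; thus
  \<open>0 < mean \<pi>\<close> includes the finiteness of the mean.
\<close>

definition mean :: "nat pmf \<Rightarrow> real" where
  "mean \<pi> = measure_pmf.expectation \<pi> real"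

definition size_biased :: "nat pmf \<Rightarrow> nat pmf" where
  "size_biased \<pi> = embed_pmf (\<lambda>k. real k * pmf \<pi> k / mean \<pi>)"

text \<open>Marks of a vertex with a \<open>\<pi>\<close>-distributed number of children in uniform order.\<close>

definition uniform_marks :: "nat pmf \<Rightarrow> nat list pmf" where
  "uniform_marks \<pi> = bind_pmf \<pi> (\<lambda>k. pmf_of_set (permutations_of_set {..<k}))"

definition iid_marks :: "nat pmf \<Rightarrow> ('i \<Rightarrow> nat list) measure" where
  "iid_marks \<pi> = PiM UNIV (\<lambda>_. measure_pmf (uniform_marks \<pi>))"

definition GW :: "nat pmf \<Rightarrow> family_tree measure" where
  "GW \<pi> = distr (iid_marks \<pi>) borel (\<lambda>\<xi>. tree_class (marked_tree \<xi> []))"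

definition SBGW :: "nat pmf \<Rightarrow> family_tree measure" where
  "SBGW \<pi> =
     scale_measure (1 / (\<integral>\<^sup>+ t. num_verts t \<partial>GW \<pi>)) (density (GW \<pi>) num_verts)"

text \<open>
  Given that the root has \<open>n\<close> ancestors, the oldest ancestor is \<open>[]\<close>, the root is
  \<open>replicate n 0\<close>, and the ancestor \<open>k\<close> generations above the root is \<open>replicate (n - k) 0\<close>,
  whose mark is \<open>\<zeta> k\<close>. So among the children of an ancestor, the one with label 0 is
  the next ancestor or the root.
\<close>

definition spine_marks ::
  "nat \<Rightarrow> (nat \<Rightarrow> nat list) \<Rightarrow> (nat list \<Rightarrow> nat list) \<Rightarrow> nat list \<Rightarrow> nat list" where
  "spine_marks n \<zeta> \<xi> v =
     (if length v < n \<and> v = replicate (length v) 0 then \<zeta> (n - length v) else \<xi> v)"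

definition TGWT :: "nat pmf \<Rightarrow> family_tree measure" where
  "TGWT \<pi> =
     distr (measure_pmf (geometric_pmf (1 - mean \<pi>)) \<Otimes>\<^sub>M
            (iid_marks (size_biased \<pi>) \<Otimes>\<^sub>M iid_marks \<pi>))
       borel
       (\<lambda>(n, \<zeta>, \<xi>). tree_class (marked_tree (spine_marks n \<zeta> \<xi>) (replicate n 0)))"


section \<open>Convergence in distribution and probabilities of the parent vertex-shift\<close>

definition weakly_converges_to ::
  "(nat \<Rightarrow> 'a::topological_space measure) \<Rightarrow> 'a measure \<Rightarrow> bool" where
  "weakly_converges_to P Q \<longleftrightarrow>
     (\<forall>n. prob_space (P n) \<and> sets (P n) = sets borel) \<and>
     prob_space Q \<and> sets Q = sets borel \<and>
     (\<forall>f :: 'a \<Rightarrow> real. continuous_on UNIV f \<and> bounded (range f) \<longrightarrow>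
        (\<lambda>n. \<integral>x. f x \<partial>P n) \<longlonglongrightarrow> (\<integral>x. f x \<partial>Q))"

text \<open>
  \<open>Q\<close> is the \<open>F\<close>-probability of \<open>P\<close> if \<open>[T, F\<^sup>n(o)]\<close> converges in distribution to \<open>Q\<close>,
  where \<open>[T, o]\<close> has law \<open>P\<close>. The required total mass 1 of all measures involved also rules
  out that one of the pushforward measures is undefined for lack of measurability.
\<close>

definition is_parent_shift_probability ::
  "family_tree measure \<Rightarrow> family_tree measure \<Rightarrow> bool" where
  "is_parent_shift_probability P Q \<longleftrightarrow>
     weakly_converges_to (\<lambda>n. distr P borel (ancestor_shift n)) Q"

end

theory Submission
  imports Defs
begin

text \<open>
  Root \<open>TGWT(\<pi>)\<close> at its oldest ancestor. Given that there are \<open>n\<close> ancestors, the law of the resulting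
  tree is that of a Galton-Watson tree biased by the size of its generation \<open>n\<close>: by exchangeability
  of the labels, the labels along the path to a vertex of generation \<open>n\<close> can be exchanged with 0, and
  summing over all such paths weights each mark on the spine by its length, that is, size-biases it.
  The expected size of generation \<open>n\<close> is \<open>m(\<pi>)\<^sup>n\<close> and \<open>n\<close> has probability \<open>m(\<pi>)\<^sup>n (1 - m(\<pi>))\<close>, so
  averaging over \<open>n\<close> gives exactly \<open>SBGW(\<pi>)\<close>. Since \<open>F\<^sup>n\<close> eventually maps the root to its oldest
  ancestor, dominated convergence concludes.
\<close>

section \<open>Measurability of functions of Family Trees\<close>

text \<open>The obstacle is that vertices are concrete words: the spine is nailed to the label 0,
  whereas a vertex of generation n of the Galton-Watson tree may be any word of length n. A mark
  orders the labels 0, ..., k - 1 uniformly, so a transposition of two labels that both occur keeps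
  its law, and moving the subtrees along keeps the isomorphism class. Afterwards the condition that
  a given word is a vertex only bounds its letters by the lengths of the marks along the word of
  zeros; hence a sum over words is a count of words, and a product of lengths appears. The expected
  size of the tree is not computed beforehand: an identity of measures, evaluated on the whole
  space, forces it to be 1/(1 - m(\<pi>)). Measurability of maps into isomorphism classes comes from
  the marks, which range over a countable product of countable sets, and from the fact that a ball
  depends on finitely many of them.\<close>

lemma tree_class_eqI:
  assumes "rooted_ordered_family_tree S" "rooted_ordered_family_tree T" "isomorphic S T"
  shows "tree_class S = tree_class T"
  using assms Quotient_rel_abs[OF Quotient_family_tree] by (simp add: family_tree_eq_def)

text \<open>
  The quotient map sends everything that is not a Family Tree to one junk value. Therefore
  \<open>\<xi> \<mapsto> tree_class (marked_tree \<xi> w)\<close> is measurable although \<open>w\<close> need not be a vertex.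
\<close>

lemma tree_class_invalid:
  assumes "\<not> rooted_ordered_family_tree S" "\<not> rooted_ordered_family_tree T"
  shows "tree_class S = tree_class T"
proof -
  have "family_tree_eq S = family_tree_eq T"
    using assms by (auto simp: family_tree_eq_def fun_eq_iff)
  moreover have "quot_type family_tree_eq Abs_family_tree Rep_family_tree"
    using family_tree_equivp Rep_family_tree Rep_family_tree_inverse Abs_family_tree_inverse
      Rep_family_tree_inject
    by (unfold_locales) blast+
  ultimately show ?thesis by (simp add: abs_family_tree_def quot_type.abs_def)
qed

text \<open>\<open>W\<close> is the union of the cylinders \<open>C p\<close> that it contains, and
  there are only countably many finite lists \<open>p\<close> of prescribed coordinates, because
  indices and values are countable.\<close>

lemma sets_PiM_finitely_determined:
  fixes W :: "('i::countable \<Rightarrow> 'a::countable) set"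
  assumes W: "\<And>\<xi>. \<xi> \<in> W \<Longrightarrow> \<exists>J. finite J \<and> (\<forall>\<xi>'. (\<forall>u \<in> J. \<xi>' u = \<xi> u) \<longrightarrow> \<xi>' \<in> W)"
  shows "W \<in> sets (PiM UNIV (\<lambda>_. count_space UNIV))"
proof -
  define C :: "('i \<times> 'a) list \<Rightarrow> ('i \<Rightarrow> 'a) set"
    where "C p = {\<xi>. \<forall>q \<in> set p. \<xi> (fst q) = snd q}" for p
  have "\<xi> \<in> (\<Union>p \<in> {p. C p \<subseteq> W}. C p)" if "\<xi> \<in> W" for \<xi> :: "'i \<Rightarrow> 'a"
  proof -
    obtain J where J: "finite J" "\<forall>\<xi>'. (\<forall>u \<in> J. \<xi>' u = \<xi> u) \<longrightarrow> \<xi>' \<in> W"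
      using W[of \<xi>] \<open>\<xi> \<in> W\<close> by blast
    obtain us where us: "set us = J" using finite_list[OF J(1)] by blast
    have "\<xi> \<in> C (map (\<lambda>u. (u, \<xi> u)) us)" "C (map (\<lambda>u. (u, \<xi> u)) us) \<subseteq> W"
      using J(2) us by (auto simp: C_def)
    then show ?thesis by blast
  qed
  then have eq: "W = (\<Union>p \<in> {p. C p \<subseteq> W}. C p)" by blast
  have "C p \<in> sets (PiM UNIV (\<lambda>_. count_space UNIV))" for p
  proof -
    have "{\<xi> \<in> space (PiM UNIV (\<lambda>_. count_space UNIV)). \<forall>q \<in> set p. \<xi> (fst q) = snd q}
      \<in> sets (PiM UNIV (\<lambda>_. count_space UNIV))"
      by measurable
    then show ?thesis by (simp add: C_def space_PiM)
  qed
  then show ?thesis by (subst eq) (auto intro!: sets.countable_UN')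
qed

lemma marked_tree_verts_snoc:
  "v @ [i] \<in> marked_tree_verts \<xi> \<longleftrightarrow> v \<in> marked_tree_verts \<xi> \<and> i \<in> set (\<xi> v)"
  by (auto intro: marked_tree_verts.intros elim: marked_tree_verts.cases)

text \<open>Unfolds the inductive definition into finitely many conditions on single marks, which is
  the form in which measurability and exchange of labels can be discussed.\<close>

lemma marked_tree_verts_iff:
  "v \<in> marked_tree_verts \<xi> \<longleftrightarrow> (\<forall>j < length v. v ! j \<in> set (\<xi> (take j v)))"
proof (induction v rule: rev_induct)
  case Nil
  then show ?case by (auto intro: marked_tree_verts.intros)
next
  case (snoc i v)
  then show ?case by (auto simp: marked_tree_verts_snoc nth_append less_Suc_eq)
qed

lemma marked_tree_verts_take:
  "v \<in> marked_tree_verts \<xi> \<Longrightarrow> take j v \<in> marked_tree_verts \<xi>"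
  by (auto simp: marked_tree_verts_iff min_def)

text \<open>Marks are finite lists, so every generation is finite; this supplies the finite set of
  marks that determines a ball.\<close>

lemma finite_marked_tree_verts_level: "finite {v \<in> marked_tree_verts \<xi>. length v \<le> n}"
proof (induction n)
  case 0
  then show ?case by simp
next
  case (Suc n)
  let ?A = "{v \<in> marked_tree_verts \<xi>. length v \<le> n}"
  have "{v \<in> marked_tree_verts \<xi>. length v \<le> Suc n} \<subseteq> insert [] (\<Union>v \<in> ?A. (\<lambda>i. v @ [i]) ` set (\<xi> v))"
  proof safe
    fix v assume v: "v \<in> marked_tree_verts \<xi>" "length v \<le> Suc n"
      "v \<notin> (\<Union>v \<in> ?A. (\<lambda>i. v @ [i]) ` set (\<xi> v))"
    show "v = []"
      using v by (cases v rule: rev_cases) (auto simp: marked_tree_verts_snoc)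
  qed
  then show ?case by (rule finite_subset) (use Suc in auto)
qed

lemma marked_tree_simps [simp]:
  "verts (marked_tree \<xi> w) = marked_tree_verts \<xi>"
  "edges (marked_tree \<xi> w) = {(v @ [i], v) | v i. v \<in> marked_tree_verts \<xi> \<and> i \<in> set (\<xi> v)}"
  "older (marked_tree \<xi> w) = {(v @ [i], v @ [j]) | v i j. v \<in> marked_tree_verts \<xi> \<and>
     j \<in> set (\<xi> v) \<and> i \<in> set (takeWhile (\<lambda>k. k \<noteq> j) (\<xi> v))}"
  "root (marked_tree \<xi> w) = w"
  by (simp_all add: marked_tree_def)

text \<open>Agreement is asked for only at vertices of the tree of \<open>\<xi>\<close>, so that
  finitely many marks are concerned. Membership is decided prefix by prefix, and both trees reject a
  word at the same prefix.\<close>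

lemma marked_tree_verts_agree:
  assumes "\<forall>u \<in> marked_tree_verts \<xi>. length u < L \<longrightarrow> \<xi>' u = \<xi> u" "length v \<le> L"
  shows "v \<in> marked_tree_verts \<xi>' \<longleftrightarrow> v \<in> marked_tree_verts \<xi>"
  using assms(2)
proof (induction v rule: rev_induct)
  case (snoc i v)
  then show ?case using assms(1) by (auto simp: marked_tree_verts_snoc)
qed (simp add: marked_tree_verts.intros)

lemma length_marked_tree_path:
  "(w, v) \<in> adj (marked_tree \<xi> w') ^^ k \<Longrightarrow> length v \<le> length w + k"
proof (induction k arbitrary: v)
  case (Suc k)
  then obtain u where u: "(w, u) \<in> adj (marked_tree \<xi> w') ^^ k" "(u, v) \<in> adj (marked_tree \<xi> w')"
    by auto
  have "length v \<le> Suc (length u)" using u(2) by (auto simp: adj_def)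
  then show ?case using Suc.IH[OF u(1)] by simp
qed simp

text \<open>Each step of a path changes the depth by at most one, so the ball stays within depth
  \<open>length w + r\<close>. The vertex labels coincide too, hence an equality of trees and not
  just an isomorphism.\<close>

lemma marked_tree_ball_agree:
  assumes agree: "\<forall>u \<in> marked_tree_verts \<xi>. length u \<le> length w + r \<longrightarrow> \<xi>' u = \<xi> u"
  shows "tree_ball r (marked_tree \<xi>' w) = tree_ball r (marked_tree \<xi> w)"
proof -
  let ?S = "marked_tree \<xi> w" and ?T = "marked_tree \<xi>' w" and ?L = "length w + r"
  have V: "v \<in> marked_tree_verts \<xi>' \<longleftrightarrow> v \<in> marked_tree_verts \<xi>" if "length v \<le> ?L" for v
    using marked_tree_verts_agree[of \<xi> ?L \<xi>' v] agree that by auto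
  have E: "(u, v) \<in> edges ?T \<longleftrightarrow> (u, v) \<in> edges ?S" if "length u \<le> ?L" "length v \<le> ?L" for u v
    using V[of v] agree that by auto
  \<comment> \<open>The order between siblings is read off from the mark of their parent, which has
    smaller depth.\<close>
  have O: "(u, v) \<in> older ?T \<longleftrightarrow> (u, v) \<in> older ?S" if uv: "length u \<le> ?L" "length v \<le> ?L" for u v
  proof -
    have "\<xi>' x = \<xi> x" if "u = x @ [i]" "x \<in> marked_tree_verts \<xi>" for x i
      using that uv agree by auto
    moreover have "x \<in> marked_tree_verts \<xi>' \<longleftrightarrow> x \<in> marked_tree_verts \<xi>" if "u = x @ [i]" for x i
      using that uv V[of x] by auto
    ultimately show ?thesis by auto
  qed
  have adj: "(u, v) \<in> adj ?T \<longleftrightarrow> (u, v) \<in> adj ?S" if "length u \<le> ?L" "length v \<le> ?L" for u v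
    using E[of u v] E[of v u] that by (simp only: adj_def Un_iff converse_iff)
  have path: "(w, v) \<in> adj ?T ^^ k \<longleftrightarrow> (w, v) \<in> adj ?S ^^ k" if "k \<le> r" for v k
    using that
  proof (induction k arbitrary: v)
    case (Suc k)
    have "(w, u) \<in> adj ?T ^^ k \<and> (u, v) \<in> adj ?T \<longleftrightarrow> (w, u) \<in> adj ?S ^^ k \<and> (u, v) \<in> adj ?S" for u
    proof -
      have l: "length u \<le> length w + k" if "(w, u) \<in> adj ?S ^^ k"
        using that by (rule length_marked_tree_path)
      have "length v \<le> Suc (length u)" if "(u, v) \<in> adj ?S \<or> (u, v) \<in> adj ?T"
        using that by (auto simp: adj_def)
      then show ?thesis using Suc l adj[of u v] by fastforce
    qed
    then show ?case by (simp only: relpow.simps relcomp_unfold mem_Collect_eq prod.case)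
  qed simp
  have B: "ball_verts r ?T = ball_verts r ?S"
  proof -
    have "length v \<le> ?L" if "(w, v) \<in> adj ?S ^^ k" "k \<le> r" for v k
      using length_marked_tree_path[OF that(1)] that(2) by simp
    then have "v \<in> marked_tree_verts \<xi>' \<and> (\<exists>k\<le>r. (w, v) \<in> adj ?S ^^ k) \<longleftrightarrow>
        v \<in> marked_tree_verts \<xi> \<and> (\<exists>k\<le>r. (w, v) \<in> adj ?S ^^ k)" for v
      using V[of v] by blast
    moreover have "(\<exists>k\<le>r. (w, v) \<in> adj ?T ^^ k) \<longleftrightarrow> (\<exists>k\<le>r. (w, v) \<in> adj ?S ^^ k)" for v
      using path by blast
    ultimately show ?thesis by (simp only: ball_verts_def marked_tree_simps)
  qed
  have "length v \<le> ?L" if v: "v \<in> ball_verts r ?S" for v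
    using v length_marked_tree_path[of w v _ \<xi> w] by (fastforce simp: ball_verts_def)
  then have "edges ?T \<inter> ball_verts r ?S \<times> ball_verts r ?S = edges ?S \<inter> ball_verts r ?S \<times> ball_verts r ?S"
    "older ?T \<inter> ball_verts r ?S \<times> ball_verts r ?S = older ?S \<inter> ball_verts r ?S \<times> ball_verts r ?S"
    using E O by blast+
  then show ?thesis unfolding tree_ball_def B by simp
qed

text \<open>An open set contains with each tree all trees sharing some ball with it, and that ball
  depends on finitely many marks; so the preimage is finitely determined.\<close>

lemma measurable_tree_class_marked_tree:
  "(\<lambda>\<xi>. tree_class (marked_tree \<xi> w)) \<in> borel_measurable (PiM UNIV (\<lambda>_. count_space UNIV))"
proof (rule borel_measurableI)
  fix U :: "family_tree set"
  assume U: "open U"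
  have "{\<xi>. tree_class (marked_tree \<xi> w) \<in> U} \<in> sets (PiM UNIV (\<lambda>_. count_space UNIV))"
  proof (rule sets_PiM_finitely_determined, unfold mem_Collect_eq)
    fix \<xi> assume in_U: "tree_class (marked_tree \<xi> w) \<in> U"
    show "\<exists>J. finite J \<and> (\<forall>\<xi>'. (\<forall>u\<in>J. \<xi>' u = \<xi> u) \<longrightarrow> tree_class (marked_tree \<xi>' w) \<in> U)"
    proof (cases "w \<in> marked_tree_verts \<xi>")
      case True
      obtain r where r: "\<And>t. ball_eq r (tree_class (marked_tree \<xi> w)) t \<Longrightarrow> t \<in> U"
        using U in_U by (auto simp: open_family_tree_def)
      have "tree_class (marked_tree \<xi>' w) \<in> U"
        if "\<forall>u \<in> {u \<in> marked_tree_verts \<xi>. length u \<le> length w + r}. \<xi>' u = \<xi> u" for \<xi>'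
      proof (rule r)
        have "w \<in> marked_tree_verts \<xi>'"
          using marked_tree_verts_agree[of \<xi> "length w + r" \<xi>' w] that True by simp
        then have "family_tree_eq (marked_tree \<xi> w) (marked_tree \<xi> w)"
          "family_tree_eq (marked_tree \<xi>' w) (marked_tree \<xi>' w)"
          using True by (auto simp: family_tree_eq_def family_tree_marked_tree isomorphic_refl)
        then show "ball_eq r (tree_class (marked_tree \<xi> w)) (tree_class (marked_tree \<xi>' w))"
          using marked_tree_ball_agree[of \<xi> w r \<xi>'] that
          by (simp add: ball_eq.abs_eq isomorphic_refl)
      qed
      then show ?thesis using finite_marked_tree_verts_level by blast
    next
      case False
      \<comment> \<open>The marks at the proper prefixes of \<open>w\<close> already decide that
        \<open>w\<close> is not a vertex, and then the class is always the same junk value.\<close>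
      have "tree_class (marked_tree \<xi>' w) \<in> U"
        if "\<forall>u \<in> (\<lambda>j. take j w) ` {..<length w}. \<xi>' u = \<xi> u" for \<xi>'
      proof -
        have "w \<notin> marked_tree_verts \<xi>'" using False that by (auto simp: marked_tree_verts_iff)
        then have "tree_class (marked_tree \<xi>' w) = tree_class (marked_tree \<xi> w)"
          using False by (intro tree_class_invalid) (auto dest: family_treeD(2))
        then show ?thesis using in_U by simp
      qed
      then show ?thesis by blast
    qed
  qed
  then show "(\<lambda>\<xi>. tree_class (marked_tree \<xi> w)) -` U \<inter> space (PiM UNIV (\<lambda>_. count_space UNIV))
      \<in> sets (PiM UNIV (\<lambda>_. count_space UNIV))"
    by (simp add: vimage_def space_PiM)
qed

section \<open>Continuity of the parent vertex-shift\<close>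

lemma parent_of_tree_ball:
  assumes T: "rooted_ordered_family_tree T"
  shows "parent_of (tree_ball (Suc r) T) (root T) = parent_of T (root T)"
proof -
  have "v \<in> ball_verts (Suc r) T" if "(root T, v) \<in> edges T" for v
    using that family_treeD[OF T] by (auto simp: ball_verts_def adj_def intro!: exI[of _ 1])
  then have "(root T, v) \<in> edges (tree_ball (Suc r) T) \<longleftrightarrow> (root T, v) \<in> edges T" for v
    using root_in_ball family_treeD[OF T] by auto
  then show ?thesis by (simp only: parent_of_def)
qed

text \<open>Moving the root along at most one edge costs one unit of radius: paths of length
  \<open>k\<close> from \<open>v\<close> are, up to one extra step, paths from the old root.\<close>

lemma tree_ball_reroot_tree_ball:
  assumes v: "v = root T \<or> (root T, v) \<in> adj T" and T: "rooted_ordered_family_tree T"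
  shows "tree_ball r (reroot v (tree_ball (Suc r) T)) = tree_ball r (reroot v T)"
proof -
  let ?B = "ball_verts (Suc r) T" and ?S = "reroot v (tree_ball (Suc r) T)" and ?T = "reroot v T"
  have adj: "adj ?S = adj T \<inter> ?B \<times> ?B" "adj ?T = adj T"
    by (auto simp: adj_def)
  have path: "(root T, u) \<in> adj T ^^ k \<or> (root T, u) \<in> adj T ^^ Suc k" if "(v, u) \<in> adj T ^^ k" for u k
    using v that relpow_Suc_I2 by fastforce
  have verts: "u \<in> verts T" if "(v, u) \<in> adj T ^^ k" for u k
  proof (cases k)
    case 0
    then show ?thesis using that v adj_subset[OF family_treeD(1)[OF T]] family_treeD(2)[OF T] by auto
  next
    case (Suc j)
    then show ?thesis using that adj_subset[OF family_treeD(1)[OF T]] by auto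
  qed
  have B: "u \<in> ?B" if "(v, u) \<in> adj T ^^ k" "k \<le> r" for u k
    unfolding ball_verts_def using path[OF that(1)] verts[OF that(1)] that(2)
    by (auto intro: exI[of _ k] exI[of _ "Suc k"] simp del: relpow.simps)
  have "(v, u) \<in> adj ?S ^^ k \<longleftrightarrow> (v, u) \<in> adj T ^^ k" if "k \<le> r" for u k
    using that
  proof (induction k arbitrary: u)
    case (Suc k)
    then show ?case using B[of _ k] B[of u "Suc k"] unfolding adj by fastforce
  qed simp
  then have eq: "ball_verts r ?S = ball_verts r ?T"
    using B ball_verts_subset[of "Suc r" T] unfolding ball_verts_def[of r] adj(2) by auto
  have "ball_verts r ?T \<subseteq> ?B"
    using B unfolding ball_verts_def[of r] adj(2) by auto
  then show ?thesis unfolding tree_ball_def[of r] eq by auto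
qed

text \<open>An isomorphism of the balls of radius \<open>Suc r\<close> respects the edge from the
  root to its parent, or the absence of such an edge. It therefore stays an isomorphism when both
  roots move to their parents.\<close>

lemma ball_eq_ancestor_shift_1:
  assumes "ball_eq (Suc r) s t"
  shows "ball_eq r (ancestor_shift 1 s) (ancestor_shift 1 t)"
  using assms
proof transfer
  fix r and S T :: "nat list rtree"
  assume *: "family_tree_eq S S" "family_tree_eq T T"
    and "isomorphic (tree_ball (Suc r) S) (tree_ball (Suc r) T)"
  then obtain f where f: "is_isomorphism f (tree_ball (Suc r) S) (tree_ball (Suc r) T)"
    by (auto simp: isomorphic_def)
  have S: "rooted_ordered_family_tree S" and T: "rooted_ordered_family_tree T"
    using * by (auto simp: family_tree_eq_def)
  define v where "v = parent_of S (root S)"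
  have adj: "parent_of R (root R) = root R \<or> (root R, parent_of R (root R)) \<in> adj R"
    if "rooted_ordered_family_tree R" for R :: "nat list rtree"
  proof (cases "\<exists>w. (root R, w) \<in> edges R")
    case True
    then show ?thesis using parent_of_eq[OF family_treeD(3)[OF that]] by (auto simp: adj_def)
  qed (auto simp: parent_of_def)
  have v: "v \<in> ball_verts (Suc r) S"
    using adj[OF S] parent_of_in_verts[OF S family_treeD(2)[OF S]]
    unfolding v_def ball_verts_def by (auto intro: exI[of _ 0] exI[of _ 1])
  have "f v = parent_of T (root T)"
  proof -
    have r: "root S \<in> ball_verts (Suc r) S" "f (root S) = root T"
      using f family_treeD(2)[OF S] by (auto simp: root_in_ball is_isomorphism_def)
    have P: "parent_of (tree_ball (Suc r) S) (root S) = v"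
      "parent_of (tree_ball (Suc r) T) (root T) = parent_of T (root T)"
      using parent_of_tree_ball S T by (auto simp: v_def)
    have sv: "single_valued (edges (tree_ball (Suc r) S))" "single_valued (edges (tree_ball (Suc r) T))"
      using family_treeD(3)[OF S] family_treeD(3)[OF T] by (auto simp: single_valued_def)
    show ?thesis
    proof (cases "\<exists>w. (root S, w) \<in> edges (tree_ball (Suc r) S)")
      case True
      then obtain w where w: "(root S, w) \<in> edges (tree_ball (Suc r) S)" by auto
      then have "w = v" using P parent_of_eq[OF sv(1)] by auto
      moreover have "(root T, f w) \<in> edges (tree_ball (Suc r) T)"
        using is_isomorphism_edges[OF f, of "root S" w] w r by auto
      ultimately show ?thesis using P parent_of_eq[OF sv(2)] by metis
    next
      case False
      have "\<nexists>w. (root T, w) \<in> edges (tree_ball (Suc r) T)"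
      proof
        assume "\<exists>w. (root T, w) \<in> edges (tree_ball (Suc r) T)"
        then obtain w where w: "(root T, w) \<in> edges (tree_ball (Suc r) T)" by auto
        then have "w \<in> f ` ball_verts (Suc r) S"
          using f unfolding is_isomorphism_def bij_betw_def by auto
        then obtain u where u: "u \<in> ball_verts (Suc r) S" "w = f u" by blast
        then show False using w False is_isomorphism_edges[OF f, of "root S" u] r by auto
      qed
      then have "parent_of (tree_ball (Suc r) T) (root T) = root T"
        unfolding parent_of_def by meson
      moreover have "parent_of (tree_ball (Suc r) S) (root S) = root S"
        using False unfolding parent_of_def by meson
      ultimately show ?thesis using P r by metis
    qed
  qed
  let ?S = "reroot v (tree_ball (Suc r) S)" and ?T = "reroot (f v) (tree_ball (Suc r) T)"
  have iso: "is_isomorphism f ?S ?T" using f by (auto simp: is_isomorphism_def)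
  have "f v \<in> ball_verts (Suc r) T" using is_isomorphism_verts[OF f] v by simp
  then have "is_isomorphism f (tree_ball r ?S) (tree_ball r ?T)"
    using is_isomorphism_tree_ball[OF iso] v by auto
  then show "isomorphic (tree_ball r (reroot ((parent_of S ^^ 1) (root S)) S))
        (tree_ball r (reroot ((parent_of T ^^ 1) (root T)) T))"
    using tree_ball_reroot_tree_ball[OF adj[OF S] S, of r] tree_ball_reroot_tree_ball[OF adj[OF T] T, of r]
      \<open>f v = _\<close> v_def
    by (auto simp: isomorphic_def)
qed

lemma ancestor_shift_0: "ancestor_shift 0 t = t"
proof transfer
  fix T :: "nat list rtree"
  assume "family_tree_eq T T"
  moreover have "reroot ((parent_of T ^^ 0) (root T)) T = T" by (simp add: reroot_def)
  ultimately show "family_tree_eq (reroot ((parent_of T ^^ 0) (root T)) T) T" by metis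
qed

lemma ancestor_shift_Suc: "ancestor_shift (Suc n) t = ancestor_shift 1 (ancestor_shift n t)"
proof transfer
  fix n and T :: "nat list rtree"
  assume "family_tree_eq T T"
  then have T: "rooted_ordered_family_tree T" by (simp add: family_tree_eq_def)
  let ?v = "(parent_of T ^^ n) (root T)"
  have "parent_of (reroot ?v T) = parent_of T" by (simp add: parent_of_def fun_eq_iff)
  moreover have "rooted_ordered_family_tree (reroot ((parent_of T ^^ Suc n) (root T)) T)"
    by (rule family_tree_reroot[OF T ancestor_in_verts[OF T]])
  ultimately show "family_tree_eq (reroot ((parent_of T ^^ Suc n) (root T)) T)
      (reroot ((parent_of (reroot ?v T) ^^ 1) (root (reroot ?v T))) (reroot ?v T))"
    by (simp add: family_tree_eq_def isomorphic_refl reroot_def)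
qed

lemma ball_eq_ancestor_shift:
  "ball_eq (r + n) s t \<Longrightarrow> ball_eq r (ancestor_shift n s) (ancestor_shift n t)"
proof (induction n arbitrary: r)
  case 0
  then show ?case by (simp add: ancestor_shift_0)
next
  case (Suc n)
  then have "ball_eq (Suc r) (ancestor_shift n s) (ancestor_shift n t)" by simp
  then show ?case unfolding ancestor_shift_Suc[of n] by (rule ball_eq_ancestor_shift_1)
qed

text \<open>Each generation uses up one unit of radius, so the ball of radius \<open>r + n\<close>
  determines the \<open>r\<close>-ball after the shift.\<close>

lemma continuous_ancestor_shift: "continuous_on UNIV (ancestor_shift n)"
  unfolding continuous_on_open_vimage[OF open_UNIV]
proof (intro allI impI)
  fix U :: "family_tree set"
  assume U: "open U"
  show "open (ancestor_shift n -` U \<inter> UNIV)"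
    unfolding open_family_tree_def
  proof
    fix s assume "s \<in> ancestor_shift n -` U \<inter> UNIV"
    then obtain r where "\<forall>t. ball_eq r (ancestor_shift n s) t \<longrightarrow> t \<in> U"
      using U by (auto simp: open_family_tree_def)
    then have "\<forall>t. ball_eq (r + n) s t \<longrightarrow> t \<in> ancestor_shift n -` U \<inter> UNIV"
      using ball_eq_ancestor_shift by blast
    then show "\<exists>r. \<forall>t. ball_eq r s t \<longrightarrow> t \<in> ancestor_shift n -` U \<inter> UNIV" ..
  qed
qed

lemma measurable_ancestor_shift [measurable]: "ancestor_shift n \<in> borel \<rightarrow>\<^sub>M borel"
  using continuous_ancestor_shift by (rule borel_measurable_continuous_onI)

section \<open>Measurability of the number of vertices\<close>

lift_definition ball_size :: "nat \<Rightarrow> family_tree \<Rightarrow> ennreal" is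
  "\<lambda>r T. emeasure (count_space UNIV) (ball_verts r T)"
proof -
  fix r and S T :: "nat list rtree"
  assume "family_tree_eq S T"
  then obtain f where f: "is_isomorphism f S T"
    and S: "rooted_ordered_family_tree S" and T: "rooted_ordered_family_tree T"
    by (auto simp: family_tree_eq_def isomorphic_def)
  have "is_isomorphism f (tree_ball r S) (tree_ball r T)"
    by (rule is_isomorphism_tree_ball[OF f family_treeD(1,2)[OF S] family_treeD(1,2)[OF T]])
  then have "bij_betw f (ball_verts r S) (ball_verts r T)" by (simp add: is_isomorphism_def)
  then show "emeasure (count_space UNIV) (ball_verts r S) = emeasure (count_space UNIV) (ball_verts r T)"
    by (auto simp: emeasure_count_space dest: bij_betw_finite bij_betw_same_card)
qed

lemma ball_size_cong: "ball_eq r s t \<Longrightarrow> ball_size r s = ball_size r t"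
proof transfer
  fix r and S T :: "nat list rtree"
  assume "isomorphic (tree_ball r S) (tree_ball r T)"
  then obtain f where "bij_betw f (ball_verts r S) (ball_verts r T)"
    by (auto simp: isomorphic_def is_isomorphism_def)
  then show "emeasure (count_space UNIV) (ball_verts r S) = emeasure (count_space UNIV) (ball_verts r T)"
    by (auto simp: emeasure_count_space dest: bij_betw_finite bij_betw_same_card)
qed

text \<open>By connectedness the balls about the root exhaust the tree.\<close>

lemma num_verts_eq_SUP_ball_size: "num_verts t = (SUP r. ball_size r t)"
proof transfer
  fix T :: "nat list rtree"
  assume "family_tree_eq T T"
  then have T: "rooted_ordered_family_tree T" by (simp add: family_tree_eq_def)
  have "v \<in> (\<Union>r. ball_verts r T)" if v: "v \<in> verts T" for v
  proof -
    have "(root T, v) \<in> (adj T)\<^sup>*"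
      using T v by (auto simp: rooted_ordered_family_tree_def directed_tree_def)
    then show ?thesis using v by (auto simp: rtrancl_power ball_verts_def)
  qed
  then have "verts T = (\<Union>r. ball_verts r T)" by (auto simp: ball_verts_def)
  then show "emeasure (count_space UNIV) (verts T) = (SUP r. emeasure (count_space UNIV) (ball_verts r T))"
    by (simp add: SUP_emeasure_incseq incseq_def ball_verts_mono)
qed

text \<open>\<open>ball_size r\<close> depends only on the \<open>r\<close>-ball, so all its
  preimages are open; \<open>num_verts\<close> is a supremum of countably many such
  functions.\<close>

lemma measurable_num_verts [measurable]: "num_verts \<in> borel_measurable borel"
proof -
  have "ball_size r \<in> borel_measurable borel" for r
  proof (rule borel_measurableI)
    fix U :: "ennreal set"
    have "\<forall>t. ball_eq r s t \<longrightarrow> t \<in> ball_size r -` U" if "s \<in> ball_size r -` U" for s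
      using ball_size_cong[of r s] that by (metis vimageE vimageI2)
    then have "open (ball_size r -` U)" unfolding open_family_tree_def by blast
    then show "ball_size r -` U \<inter> space borel \<in> sets borel" by simp
  qed
  then have "(\<lambda>t. SUP r. ball_size r t) \<in> borel_measurable borel" by measurable
  then show ?thesis using num_verts_eq_SUP_ball_size by presburger
qed

section \<open>Relabelling of marked trees\<close>

text \<open>If every \<open>\<tau> u\<close> is a bijection, this is an automorphism of the tree of
  all words that fixes the empty word. The bijection for a letter is selected by the original
  prefix, not by the relabelled one.\<close>

definition relabel :: "(nat list \<Rightarrow> nat \<Rightarrow> nat) \<Rightarrow> nat list \<Rightarrow> nat list" where
  "relabel \<tau> u = map (\<lambda>j. \<tau> (take j u) (u ! j)) [0..<length u]"

lemma relabel_Nil [simp]: "relabel \<tau> [] = []"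
  by (simp add: relabel_def)

lemma relabel_snoc [simp]: "relabel \<tau> (u @ [i]) = relabel \<tau> u @ [\<tau> u i]"
  by (simp add: relabel_def nth_append)

lemma bij_relabel:
  assumes "\<And>u. bij (\<tau> u)"
  shows "bij (relabel \<tau>)"
proof (rule bijI)
  have "relabel \<tau> u = relabel \<tau> v \<Longrightarrow> u = v" for u v
  proof (induction u arbitrary: v rule: rev_induct)
    case Nil
    then show ?case by (cases v rule: rev_cases) auto
  next
    case (snoc i u)
    then show ?case by (cases v rule: rev_cases) (use assms in \<open>auto dest: bij_is_inj injD\<close>)
  qed
  then show "inj (relabel \<tau>)" by (rule injI)
  have "\<exists>u. relabel \<tau> u = v" for v
  proof (induction v rule: rev_induct)
    case Nil
    then show ?case using relabel_Nil by blast
  next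
    case (snoc i v)
    then obtain u where u: "relabel \<tau> u = v" by blast
    obtain j where "\<tau> u j = i" using assms[of u] by (metis bij_is_surj surjD)
    then have "relabel \<tau> (u @ [j]) = v @ [i]" using u by simp
    then show ?case by blast
  qed
  then show "surj (relabel \<tau>)" by (metis surjI)
qed

text \<open>\<open>map\<close> moves the labels but keeps the positions in each mark, and positions
  encode the order among siblings; so edges and order are both transported.\<close>

lemma
  assumes \<tau>: "\<And>u. bij (\<tau> u)"
    and \<xi>': "\<And>u. u \<in> marked_tree_verts \<xi> \<Longrightarrow> \<xi>' (relabel \<tau> u) = map (\<tau> u) (\<xi> u)"
  shows relabel_in_verts_iff: "relabel \<tau> u \<in> marked_tree_verts \<xi>' \<longleftrightarrow> u \<in> marked_tree_verts \<xi>"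
    and isomorphic_relabel: "isomorphic (marked_tree \<xi> []) (marked_tree \<xi>' [])"
proof -
  let ?f = "relabel \<tau>" and ?V = "marked_tree_verts \<xi>" and ?V' = "marked_tree_verts \<xi>'"
  have inj: "\<tau> u i = \<tau> u j \<longleftrightarrow> i = j" for u i j
    using \<tau>[of u] by (simp add: bij_is_inj inj_eq)
  have V: "?f u \<in> ?V' \<longleftrightarrow> u \<in> ?V" for u
  proof (induction u rule: rev_induct)
    case Nil
    then show ?case by (simp add: marked_tree_verts.intros)
  next
    case (snoc i u)
    then show ?case using \<xi>'[of u] by (auto simp: marked_tree_verts_snoc inj)
  qed
  then show "?f u \<in> ?V' \<longleftrightarrow> u \<in> ?V" .
  have f: "?f u = ?f v \<longleftrightarrow> u = v" for u v
    using bij_relabel[of \<tau>] \<tau> by (simp add: bij_is_inj inj_eq)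
  have snoc: "?f u = ?f v @ [k] \<longleftrightarrow> (\<exists>i. u = v @ [i] \<and> k = \<tau> v i)" for u v k
    by (cases u rule: rev_cases) (auto simp: f)
  have surj: "\<exists>u. ?f u = v" for v
    using bij_relabel[of \<tau>] \<tau> by (metis bij_is_surj surjD)
  have tW: "takeWhile (\<lambda>k. k \<noteq> \<tau> v j) (map (\<tau> v) xs) = map (\<tau> v) (takeWhile (\<lambda>k. k \<noteq> j) xs)"
    for v j xs
    by (simp add: takeWhile_map comp_def inj)
  have "bij_betw ?f ?V ?V'"
    unfolding bij_betw_def
  proof
    show "inj_on ?f ?V" by (auto simp: inj_on_def f)
    show "?f ` ?V = ?V'"
    proof
      show "?f ` ?V \<subseteq> ?V'" using V by auto
      show "?V' \<subseteq> ?f ` ?V" using V surj by (metis imageI subsetI)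
    qed
  qed
  moreover have "(u, v) \<in> edges (marked_tree \<xi> []) \<longleftrightarrow> (?f u, ?f v) \<in> edges (marked_tree \<xi>' [])" for u v
    using \<xi>'[of v] by (auto simp: snoc V inj)
  moreover have "(u, v) \<in> older (marked_tree \<xi> []) \<longleftrightarrow> (?f u, ?f v) \<in> older (marked_tree \<xi>' [])" for u v
  proof
    assume "(u, v) \<in> older (marked_tree \<xi> [])"
    then obtain w i j where w: "u = w @ [i]" "v = w @ [j]" "w \<in> ?V" "j \<in> set (\<xi> w)"
      "i \<in> set (takeWhile (\<lambda>k. k \<noteq> j) (\<xi> w))" by auto
    then have "?f w \<in> ?V'" "\<tau> w j \<in> set (\<xi>' (?f w))"
      "\<tau> w i \<in> set (takeWhile (\<lambda>k. k \<noteq> \<tau> w j) (\<xi>' (?f w)))"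
      by (auto simp: V \<xi>' tW)
    then show "(?f u, ?f v) \<in> older (marked_tree \<xi>' [])" using w by auto
  next
    assume "(?f u, ?f v) \<in> older (marked_tree \<xi>' [])"
    then obtain w' i' j' where w': "?f u = w' @ [i']" "?f v = w' @ [j']" "w' \<in> ?V'" "j' \<in> set (\<xi>' w')"
      "i' \<in> set (takeWhile (\<lambda>k. k \<noteq> j') (\<xi>' w'))" by auto
    obtain w where w: "w' = ?f w" using surj by metis
    obtain i j where ij: "u = w @ [i]" "i' = \<tau> w i" "v = w @ [j]" "j' = \<tau> w j"
      using w' unfolding w snoc by blast
    have "w \<in> ?V" using w' w V by simp
    then show "(u, v) \<in> older (marked_tree \<xi> [])"
      using w' unfolding w ij by (auto simp: \<xi>' tW inj)
  qed
  ultimately have "is_isomorphism ?f (marked_tree \<xi> []) (marked_tree \<xi>' [])"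
    unfolding is_isomorphism_def
    by (intro conjI ballI) (simp_all only: marked_tree_simps(1,4) relabel_Nil)
  then show "isomorphic (marked_tree \<xi> []) (marked_tree \<xi>' [])" by (auto simp: isomorphic_def)
qed

section \<open>Independent marks and the size-biased spine\<close>

lemma cylinder_in_sets:
  fixes A :: "'i \<Rightarrow> 'a set"
  assumes "finite J"
  shows "{\<xi>. \<forall>i \<in> J. \<xi> i \<in> A i} \<in> sets (PiM UNIV (\<lambda>_::'i. count_space UNIV))"
proof -
  have [measurable]: "Measurable.pred (PiM UNIV (\<lambda>_::'i. count_space UNIV)) (\<lambda>\<xi>. \<xi> i \<in> A i)" for i
    by (rule measurable_compose[OF measurable_component_singleton[of i UNIV]]) auto
  have "{\<xi> \<in> space (PiM UNIV (\<lambda>_::'i. count_space UNIV)). \<forall>i \<in> J. \<xi> i \<in> A i}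
      \<in> sets (PiM UNIV (\<lambda>_::'i. count_space UNIV))"
    using assms by measurable
  then show ?thesis by (simp add: space_PiM)
qed

lemma emeasure_PiM_pmf:
  assumes "finite J"
  shows "emeasure (PiM UNIV (\<lambda>i. measure_pmf (\<mu> i))) {\<xi>. \<forall>i \<in> J. \<xi> i \<in> A i} =
    (\<Prod>i \<in> J. emeasure (measure_pmf (\<mu> i)) (A i))"
proof -
  interpret product_prob_space "\<lambda>i. measure_pmf (\<mu> i)" UNIV
    by (rule product_prob_spaceI) (rule prob_space_measure_pmf)
  show ?thesis using emeasure_PiM_Collect[of J A] assms by (simp add: space_PiM)
qed

lemma sets_PiM_pmf: "sets (PiM I (\<lambda>i. measure_pmf (\<mu> i))) = sets (PiM I (\<lambda>_. count_space UNIV))"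
  by (rule sets_PiM_cong) auto

text \<open>Finite-dimensional cylinders determine a probability measure on the product. The law of
  exchanged marks, the law of \<open>spine_marks\<close> and the biased law are all identified in
  this way.\<close>

lemma measure_eq_PiM_pmfI:
  assumes "sets P = sets (PiM UNIV (\<lambda>_. count_space UNIV))"
    and "\<And>J A. finite J \<Longrightarrow>
      emeasure P {\<xi>. \<forall>i \<in> J. \<xi> i \<in> A i} = (\<Prod>i \<in> J. emeasure (measure_pmf (\<mu> i)) (A i))"
  shows "P = PiM UNIV (\<lambda>i. measure_pmf (\<mu> i))"
proof (rule measure_eqI_PiM_infinite[symmetric])
  show "sets P = sets (PiM UNIV (\<lambda>i. measure_pmf (\<mu> i)))"
    using assms(1) sets_PiM_pmf by blast
  interpret prob_space "PiM UNIV (\<lambda>i. measure_pmf (\<mu> i))"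
    by (rule prob_space_PiM) (rule prob_space_measure_pmf)
  show "finite_measure (PiM UNIV (\<lambda>i. measure_pmf (\<mu> i)))" by (rule finite_measure_axioms)
  fix A :: "'a \<Rightarrow> 'b set" and J :: "'a set" assume J: "finite J"
  have "prod_emb UNIV (\<lambda>i. measure_pmf (\<mu> i)) J (Pi\<^sub>E J A) = {\<xi>. \<forall>i \<in> J. \<xi> i \<in> A i}"
    by (auto simp: prod_emb_def PiE_iff)
  then show "emeasure (PiM UNIV (\<lambda>i. measure_pmf (\<mu> i))) (prod_emb UNIV (\<lambda>i. measure_pmf (\<mu> i)) J (Pi\<^sub>E J A)) =
      emeasure P (prod_emb UNIV (\<lambda>i. measure_pmf (\<mu> i)) J (Pi\<^sub>E J A))"
    using assms(2)[OF J] emeasure_PiM_pmf[OF J] by simp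
qed simp

lemma nn_integral_PiM_pmf_prod:
  fixes g :: "'i \<Rightarrow> 'a \<Rightarrow> ennreal"
  assumes "finite K"
  shows "(\<integral>\<^sup>+ \<xi>. (\<Prod>i \<in> K. g i (\<xi> i)) \<partial>PiM UNIV (\<lambda>i. measure_pmf (\<mu> i))) =
    (\<Prod>i \<in> K. \<integral>\<^sup>+ x. g i x \<partial>measure_pmf (\<mu> i))"
proof -
  interpret product_prob_space "\<lambda>i. measure_pmf (\<mu> i)" UNIV
    by (rule product_prob_spaceI) (rule prob_space_measure_pmf)
  have g: "(\<lambda>\<xi>. \<Prod>i \<in> K. g i (\<xi> i)) \<in> borel_measurable (PiM K (\<lambda>i. measure_pmf (\<mu> i)))"
    by (intro borel_measurable_prod_ennreal measurable_compose[OF measurable_component_singleton]) auto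
  have "(\<Prod>i \<in> K. \<integral>\<^sup>+ x. g i x \<partial>measure_pmf (\<mu> i)) =
      (\<integral>\<^sup>+ \<xi>. (\<Prod>i \<in> K. g i (\<xi> i)) \<partial>PiM K (\<lambda>i. measure_pmf (\<mu> i)))"
    using assms by (intro product_nn_integral_prod[symmetric]) auto
  also have "\<dots> = (\<integral>\<^sup>+ \<xi>. (\<Prod>i \<in> K. g i (restrict \<xi> K i)) \<partial>PiM UNIV (\<lambda>i. measure_pmf (\<mu> i)))"
    by (subst distr_PiM_restrict_finite[OF assms subset_UNIV, symmetric],
        rule nn_integral_distr[OF measurable_restrict_subset[OF subset_UNIV]]) (simp add: g)
  finally show ?thesis by simp
qed

text \<open>Injectivity of \<open>\<rho>\<close> turns constraints at \<open>J\<close> into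
  constraints at distinct, hence independent coordinates, and each \<open>h i\<close> preserves the
  marginal law. This is the invariance behind exchanging labels.\<close>

lemma distr_PiM_pmf_transform:
  fixes h :: "'i \<Rightarrow> 'a \<Rightarrow> 'a"
  assumes \<rho>: "inj \<rho>" and h: "\<And>i. map_pmf (h i) \<mu> = \<mu>"
  shows "distr (PiM UNIV (\<lambda>_. measure_pmf \<mu>)) (PiM UNIV (\<lambda>_. count_space UNIV)) (\<lambda>\<xi> i. h i (\<xi> (\<rho> i))) =
    PiM UNIV (\<lambda>_::'i. measure_pmf \<mu>)"
proof (rule measure_eq_PiM_pmfI)
  have m: "(\<lambda>\<xi> i. h i (\<xi> (\<rho> i))) \<in> PiM UNIV (\<lambda>_. measure_pmf \<mu>) \<rightarrow>\<^sub>M PiM UNIV (\<lambda>_::'i. count_space UNIV)"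
    by (rule measurable_PiM_single') (auto intro!: measurable_compose[OF measurable_component_singleton])
  fix J :: "'i set" and A :: "'i \<Rightarrow> 'a set" assume J: "finite J"
  have "(\<lambda>\<xi> i. h i (\<xi> (\<rho> i))) -` {\<xi>. \<forall>i \<in> J. \<xi> i \<in> A i} =
      {\<xi>. \<forall>j \<in> \<rho> ` J. \<xi> j \<in> h (inv \<rho> j) -` A (inv \<rho> j)}"
    using \<rho> by auto
  moreover have "{\<xi>. \<forall>i \<in> J. \<xi> i \<in> A i} \<in> sets (PiM UNIV (\<lambda>_::'i. count_space UNIV))"
    using J by (rule cylinder_in_sets)
  ultimately have "emeasure (distr (PiM UNIV (\<lambda>_. measure_pmf \<mu>)) (PiM UNIV (\<lambda>_. count_space UNIV))
      (\<lambda>\<xi> i. h i (\<xi> (\<rho> i)))) {\<xi>. \<forall>i \<in> J. \<xi> i \<in> A i} =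
      emeasure (PiM UNIV (\<lambda>_. measure_pmf \<mu>)) {\<xi>. \<forall>j \<in> \<rho> ` J. \<xi> j \<in> h (inv \<rho> j) -` A (inv \<rho> j)}"
    using m by (simp add: emeasure_distr space_PiM)
  also have "\<dots> = (\<Prod>j \<in> \<rho> ` J. emeasure (measure_pmf \<mu>) (h (inv \<rho> j) -` A (inv \<rho> j)))"
    using J by (intro emeasure_PiM_pmf) simp
  also have "\<dots> = (\<Prod>i \<in> J. emeasure (measure_pmf \<mu>) (h i -` A i))"
    using \<rho> by (simp add: prod.reindex inj_on_subset)
  also have "\<dots> = (\<Prod>i \<in> J. emeasure (measure_pmf \<mu>) (A i))"
    by (intro prod.cong refl) (metis h emeasure_map_pmf)
  finally show "emeasure (distr (PiM UNIV (\<lambda>_. measure_pmf \<mu>)) (PiM UNIV (\<lambda>_. count_space UNIV))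
      (\<lambda>\<xi> i. h i (\<xi> (\<rho> i)))) {\<xi>. \<forall>i \<in> J. \<xi> i \<in> A i} = (\<Prod>i \<in> J. emeasure (measure_pmf \<mu>) (A i))" .
qed simp

section \<open>Uniform and size-biased marks\<close>

lemma pmf_uniform_marks:
  "pmf (uniform_marks \<pi>) xs =
    pmf \<pi> (length xs) * indicator (permutations_of_set {..<length xs}) xs / fact (length xs)"
proof -
  have "pmf (pmf_of_set (permutations_of_set {..<k})) xs =
      indicator {length xs} k * (indicator (permutations_of_set {..<length xs}) xs / fact (length xs))" for k
    by (auto simp: indicator_def dest: length_finite_permutations_of_set)
  then show ?thesis
    by (simp add: uniform_marks_def pmf_bind measure_pmf_single)
qed

lemma set_uniform_marks:
  "xs \<in> set_pmf (uniform_marks \<pi>) \<Longrightarrow> set xs = {..<length xs}"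
  by (auto simp: set_pmf_iff pmf_uniform_marks indicator_def permutations_of_set_def split: if_splits)

text \<open>
  Restricting the transposition to lists that contain both labels makes it an involution that
  preserves the law of the marks.
\<close>

definition swap_first :: "nat \<Rightarrow> nat list \<Rightarrow> nat list" where
  "swap_first a xs = (if {0, a} \<subseteq> set xs then map (Transposition.transpose 0 a) xs else xs)"

lemma length_swap_first [simp]: "length (swap_first a xs) = length xs"
  by (simp add: swap_first_def)

lemma set_swap_first [simp]: "set (swap_first a xs) = set xs"
  by (auto simp: swap_first_def Transposition.transpose_def image_iff)

lemma swap_first_swap_first [simp]: "swap_first a (swap_first a xs) = xs"
proof (cases "{0, a} \<subseteq> set xs")
  case True
  then have "{0, a} \<subseteq> set (swap_first a xs)" by simp
  moreover have "swap_first a xs = map (Transposition.transpose 0 a) xs" using True by (simp add: swap_first_def)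
  ultimately show ?thesis by (simp add: swap_first_def comp_def)
qed (auto simp: swap_first_def)

text \<open>The probability of a list depends only on its length, its set of labels and its
  distinctness, and the involution preserves all three.\<close>

lemma map_pmf_swap_first: "map_pmf (swap_first a) (uniform_marks \<pi>) = uniform_marks \<pi>"
proof (rule pmf_eqI)
  fix xs
  have inj: "inj (swap_first a)" by (metis injI swap_first_swap_first)
  have "distinct (swap_first a xs) \<longleftrightarrow> distinct xs"
    by (metis card_distinct distinct_card length_swap_first set_swap_first)
  then have "pmf (uniform_marks \<pi>) (swap_first a xs) = pmf (uniform_marks \<pi>) xs"
    by (simp add: pmf_uniform_marks permutations_of_set_def indicator_def)
  then show "pmf (map_pmf (swap_first a) (uniform_marks \<pi>)) xs = pmf (uniform_marks \<pi>) xs"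
    using pmf_map_inj'[OF inj, of "uniform_marks \<pi>" "swap_first a xs"] by simp
qed

lemma pmf_size_biased:
  assumes "0 < mean \<pi>"
  shows "pmf (size_biased \<pi>) k = real k * pmf \<pi> k / mean \<pi>"
  unfolding size_biased_def
proof (rule pmf_embed_pmf)
  show "0 \<le> real k * pmf \<pi> k / mean \<pi>" for k using assms by simp
  \<comment> \<open>A non-integrable expectation would have the default value 0, which the
    positivity of the mean excludes.\<close>
  have int: "integrable (measure_pmf \<pi>) real"
    using assms not_integrable_integral_eq unfolding mean_def by fastforce
  have "(\<integral>\<^sup>+ k. ennreal (real k * pmf \<pi> k / mean \<pi>) \<partial>count_space UNIV) =
      (\<integral>\<^sup>+ k. ennreal (1 / mean \<pi>) * (ennreal (pmf \<pi> k) * ennreal (real k)) \<partial>count_space UNIV)"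
    using assms by (intro nn_integral_cong) (simp add: ennreal_mult'[symmetric] mult.commute)
  also have "\<dots> = ennreal (1 / mean \<pi>) * (\<integral>\<^sup>+ k. ennreal (real k) \<partial>measure_pmf \<pi>)"
    by (simp add: nn_integral_cmult nn_integral_measure_pmf)
  also have "(\<integral>\<^sup>+ k. ennreal (real k) \<partial>measure_pmf \<pi>) = ennreal (mean \<pi>)"
    unfolding mean_def using int by (intro nn_integral_eq_integral) auto
  also have "ennreal (1 / mean \<pi>) * ennreal (mean \<pi>) = 1"
    using assms by (simp add: ennreal_mult'[symmetric])
  finally show "(\<integral>\<^sup>+ k. ennreal (real k * pmf \<pi> k / mean \<pi>) \<partial>count_space UNIV) = 1" .
qed

text \<open>Given its length, a mark has the same conditional law under both offspring
  distributions, so biasing the number of children amounts to weighting the mark by its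
  length.\<close>

lemma emeasure_uniform_marks_size_biased:
  assumes "0 < mean \<pi>"
  shows "emeasure (measure_pmf (uniform_marks (size_biased \<pi>))) A =
    (\<integral>\<^sup>+ xs. ennreal (real (length xs) / mean \<pi>) * indicator A xs \<partial>measure_pmf (uniform_marks \<pi>))"
proof -
  have "pmf (uniform_marks (size_biased \<pi>)) xs = pmf (uniform_marks \<pi>) xs * (real (length xs) / mean \<pi>)" for xs
    using assms by (simp add: pmf_uniform_marks pmf_size_biased ac_simps)
  then have "ennreal (pmf (uniform_marks (size_biased \<pi>)) xs) =
      ennreal (pmf (uniform_marks \<pi>) xs) * ennreal (real (length xs) / mean \<pi>)" for xs
    using assms by (simp add: ennreal_mult[symmetric])
  moreover have "emeasure (measure_pmf (uniform_marks (size_biased \<pi>))) A =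
      (\<integral>\<^sup>+ xs. indicator A xs \<partial>measure_pmf (uniform_marks (size_biased \<pi>)))"
    by simp
  ultimately show ?thesis by (simp add: nn_integral_measure_pmf mult.assoc)
qed

section \<open>Marks with a size-biased spine\<close>

definition spine :: "nat \<Rightarrow> nat list set" where
  "spine n = (\<lambda>j. replicate j 0) ` {..<n}"

lemma spine_marks_eq: "spine_marks n \<zeta> \<xi> u = (if u \<in> spine n then \<zeta> (n - length u) else \<xi> u)"
  by (auto simp: spine_marks_def spine_def)

text \<open>Meeting point of the two descriptions: it is the law of the marks of \<open>TGWT\<close>
  given n ancestors, and also a reweighting of the Galton-Watson marks. The vertex
  \<open>replicate n 0\<close>, the root of \<open>TGWT\<close>, lies outside \<open>spine n\<close>
  and keeps the offspring distribution \<pi>.\<close>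

definition spine_law :: "nat pmf \<Rightarrow> nat \<Rightarrow> (nat list \<Rightarrow> nat list) measure" where
  "spine_law \<pi> n =
     PiM UNIV (\<lambda>u. measure_pmf (uniform_marks (if u \<in> spine n then size_biased \<pi> else \<pi>)))"

lemma sets_iid_marks: "sets (iid_marks \<pi>) = sets (PiM UNIV (\<lambda>_. count_space UNIV))"
  unfolding iid_marks_def by (rule sets_PiM_pmf)

lemma space_iid_marks [simp]: "space (iid_marks \<pi>) = UNIV"
  by (simp add: iid_marks_def space_PiM)

lemma prob_space_iid_marks: "prob_space (iid_marks \<pi>)"
  unfolding iid_marks_def by (rule prob_space_PiM) (rule prob_space_measure_pmf)

lemma measurable_iid_marks_component [measurable]:
  "(\<lambda>\<xi>. \<xi> i) \<in> iid_marks \<pi> \<rightarrow>\<^sub>M count_space UNIV"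
  unfolding iid_marks_def by (rule measurable_compose[OF measurable_component_singleton]) auto

lemma measurable_spine_marks:
  "(\<lambda>(\<zeta>, \<xi>). spine_marks n \<zeta> \<xi>) \<in>
    iid_marks \<pi> \<Otimes>\<^sub>M iid_marks \<pi>' \<rightarrow>\<^sub>M PiM UNIV (\<lambda>_. count_space UNIV)"
proof (rule measurable_PiM_single')
  fix u
  show "(\<lambda>x. (case x of (\<zeta>, \<xi>) \<Rightarrow> spine_marks n \<zeta> \<xi>) u) \<in>
      iid_marks \<pi> \<Otimes>\<^sub>M iid_marks \<pi>' \<rightarrow>\<^sub>M count_space UNIV"
    by (cases "u \<in> spine n") (simp_all add: spine_marks_eq split_beta)
qed auto

lemma distr_spine_marks:
  "distr (iid_marks (size_biased \<pi>) \<Otimes>\<^sub>M iid_marks \<pi>) (PiM UNIV (\<lambda>_. count_space UNIV))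
     (\<lambda>(\<zeta>, \<xi>). spine_marks n \<zeta> \<xi>) = spine_law \<pi> n"
  unfolding spine_law_def
proof (rule measure_eq_PiM_pmfI)
  fix J :: "nat list set" and A :: "nat list \<Rightarrow> nat list set" assume J: "finite J"
  let ?P = "iid_marks (size_biased \<pi>)" and ?Q = "iid_marks \<pi>"
  let ?idx = "\<lambda>u::nat list. n - length u" and ?S = "J \<inter> spine n"
  interpret Q: prob_space ?Q by (rule prob_space_iid_marks)
  have inj: "inj_on ?idx ?S" by (auto simp: inj_on_def spine_def)
  \<comment> \<open>On the spine the generation index recovers the vertex, so distinct spine
    vertices read distinct coordinates of \<open>\<zeta>\<close>, and a cylinder pulls back to a
    rectangle \<open>X \<times> Y\<close>.\<close>
  have inv: "replicate (n - ?idx u) 0 = u" if "u \<in> spine n" for u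
    using that by (auto simp: spine_def)
  define X where "X = {\<zeta>. \<forall>k \<in> ?idx ` ?S. \<zeta> k \<in> A (replicate (n - k) 0)}"
  define Y where "Y = {\<xi>. \<forall>u \<in> J - spine n. \<xi> u \<in> A u}"
  have "X \<in> sets ?P"
    unfolding X_def sets_iid_marks by (rule cylinder_in_sets) (use J in simp)
  moreover have "Y \<in> sets ?Q"
    unfolding Y_def sets_iid_marks by (rule cylinder_in_sets) (use J in simp)
  ultimately have XY: "X \<in> sets ?P" "Y \<in> sets ?Q" .
  have "(\<lambda>(\<zeta>, \<xi>). spine_marks n \<zeta> \<xi>) -` {\<xi>. \<forall>u \<in> J. \<xi> u \<in> A u} = X \<times> Y"
    using inv by (auto simp: X_def Y_def spine_marks_eq)
  then have "emeasure (distr (?P \<Otimes>\<^sub>M ?Q) (PiM UNIV (\<lambda>_. count_space UNIV)) (\<lambda>(\<zeta>, \<xi>). spine_marks n \<zeta> \<xi>))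
      {\<xi>. \<forall>u \<in> J. \<xi> u \<in> A u} = emeasure (?P \<Otimes>\<^sub>M ?Q) (X \<times> Y)"
    using J by (simp add: emeasure_distr[OF measurable_spine_marks cylinder_in_sets] space_pair_measure)
  also have "\<dots> = emeasure ?P X * emeasure ?Q Y"
    using XY by (rule Q.emeasure_pair_measure_Times)
  also have "emeasure ?P X = (\<Prod>u \<in> ?S. emeasure (measure_pmf (uniform_marks (size_biased \<pi>))) (A u))"
    using J inv unfolding X_def iid_marks_def
    by (subst emeasure_PiM_pmf) (auto simp: prod.reindex[OF inj] intro!: prod.cong)
  also have "emeasure ?Q Y = (\<Prod>u \<in> J - spine n. emeasure (measure_pmf (uniform_marks \<pi>)) (A u))"
    using J unfolding Y_def iid_marks_def by (intro emeasure_PiM_pmf) auto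
  also have "(\<Prod>u \<in> ?S. emeasure (measure_pmf (uniform_marks (size_biased \<pi>))) (A u)) *
      (\<Prod>u \<in> J - spine n. emeasure (measure_pmf (uniform_marks \<pi>)) (A u)) =
      (\<Prod>u \<in> J. emeasure (measure_pmf (uniform_marks (if u \<in> spine n then size_biased \<pi> else \<pi>))) (A u))"
    by (subst prod.Int_Diff[OF J, of _ "spine n"]) simp
  finally show "emeasure (distr (?P \<Otimes>\<^sub>M ?Q) (PiM UNIV (\<lambda>_. count_space UNIV)) (\<lambda>(\<zeta>, \<xi>). spine_marks n \<zeta> \<xi>))
      {\<xi>. \<forall>u \<in> J. \<xi> u \<in> A u} =
      (\<Prod>u \<in> J. emeasure (measure_pmf (uniform_marks (if u \<in> spine n then size_biased \<pi> else \<pi>))) (A u))" .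
qed simp

lemma measurable_spine_density:
  "(\<lambda>\<xi>. \<Prod>u \<in> spine n. ennreal (real (length (\<xi> u)) / c)) \<in> borel_measurable (iid_marks \<pi>)"
  by measurable

text \<open>The density is a product over spine coordinates, and each factor has mean 1 under
  \<pi>-marks; it thus biases every spine mark separately and preserves independence.\<close>

lemma density_spine_law:
  assumes "0 < mean \<pi>"
  shows "density (iid_marks \<pi>) (\<lambda>\<xi>. \<Prod>u \<in> spine n. ennreal (real (length (\<xi> u)) / mean \<pi>)) = spine_law \<pi> n"
  unfolding spine_law_def
proof (rule measure_eq_PiM_pmfI)
  show "sets (density (iid_marks \<pi>) (\<lambda>\<xi>. \<Prod>u \<in> spine n. ennreal (real (length (\<xi> u)) / mean \<pi>))) =
      sets (PiM UNIV (\<lambda>_. count_space UNIV))"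
    by (simp add: sets_iid_marks)
  fix J :: "nat list set" and A :: "nat list \<Rightarrow> nat list set" assume J: "finite J"
  let ?w = "\<lambda>xs::nat list. ennreal (real (length xs) / mean \<pi>)"
  let ?K = "J \<union> spine n"
  have S: "finite (spine n)" by (simp add: spine_def)
  \<comment> \<open>Padding with 1 lets the weights and the indicators run over the same finite
    index set.\<close>
  define g where "g u xs = (if u \<in> spine n then ?w xs else 1) * (if u \<in> J then indicator (A u) xs else 1)" for u xs
  have "emeasure (density (iid_marks \<pi>) (\<lambda>\<xi>. \<Prod>u \<in> spine n. ?w (\<xi> u))) {\<xi>. \<forall>u \<in> J. \<xi> u \<in> A u} =
      (\<integral>\<^sup>+ \<xi>. (\<Prod>u \<in> spine n. ?w (\<xi> u)) * indicator {\<xi>. \<forall>u \<in> J. \<xi> u \<in> A u} \<xi> \<partial>iid_marks \<pi>)"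
    using J by (intro emeasure_density measurable_spine_density) (simp add: sets_iid_marks cylinder_in_sets)
  also have "\<dots> = (\<integral>\<^sup>+ \<xi>. (\<Prod>u \<in> ?K. g u (\<xi> u)) \<partial>iid_marks \<pi>)"
  proof (intro nn_integral_cong)
    fix \<xi> :: "nat list \<Rightarrow> nat list"
    have "indicator {\<xi>. \<forall>u \<in> J. \<xi> u \<in> A u} \<xi> = (\<Prod>u \<in> J. indicator (A u) (\<xi> u) :: ennreal)"
      using J by (auto simp: indicator_def prod_zero_iff)
    also have "\<dots> = (\<Prod>u \<in> ?K. if u \<in> J then indicator (A u) (\<xi> u) else 1)"
      using J S by (intro prod.mono_neutral_cong_left) auto
    moreover have "(\<Prod>u \<in> spine n. ?w (\<xi> u)) = (\<Prod>u \<in> ?K. if u \<in> spine n then ?w (\<xi> u) else 1)"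
      using J S by (intro prod.mono_neutral_cong_left) auto
    ultimately show "(\<Prod>u \<in> spine n. ?w (\<xi> u)) * indicator {\<xi>. \<forall>u \<in> J. \<xi> u \<in> A u} \<xi> = (\<Prod>u \<in> ?K. g u (\<xi> u))"
      by (simp only: g_def prod.distrib)
  qed
  also have "\<dots> = (\<Prod>u \<in> ?K. \<integral>\<^sup>+ xs. g u xs \<partial>measure_pmf (uniform_marks \<pi>))"
    unfolding iid_marks_def using J S by (intro nn_integral_PiM_pmf_prod) simp
  also have "\<dots> = (\<Prod>u \<in> ?K. if u \<in> J then
      emeasure (measure_pmf (uniform_marks (if u \<in> spine n then size_biased \<pi> else \<pi>))) (A u) else 1)"
  proof (intro prod.cong refl)
    fix u assume u: "u \<in> ?K"
    \<comment> \<open>Covers spine vertices outside \<open>J\<close>, which carry a weight but no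
      constraint.\<close>
    have one: "(\<integral>\<^sup>+ xs. ?w xs \<partial>measure_pmf (uniform_marks \<pi>)) = 1"
      using emeasure_uniform_marks_size_biased[OF assms, of UNIV]
        measure_pmf.emeasure_space_1[of "uniform_marks (size_biased \<pi>)"] by simp
    show "(\<integral>\<^sup>+ xs. g u xs \<partial>measure_pmf (uniform_marks \<pi>)) = (if u \<in> J then
      emeasure (measure_pmf (uniform_marks (if u \<in> spine n then size_biased \<pi> else \<pi>))) (A u) else 1)"
      using u one by (auto simp: g_def emeasure_uniform_marks_size_biased[OF assms])
  qed
  also have "\<dots> = (\<Prod>u \<in> J.
      emeasure (measure_pmf (uniform_marks (if u \<in> spine n then size_biased \<pi> else \<pi>))) (A u))"
    using J S by (intro prod.mono_neutral_cong_right) auto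
  finally show "emeasure (density (iid_marks \<pi>) (\<lambda>\<xi>. \<Prod>u \<in> spine n. ?w (\<xi> u))) {\<xi>. \<forall>u \<in> J. \<xi> u \<in> A u} =
      (\<Prod>u \<in> J. emeasure (measure_pmf (uniform_marks (if u \<in> spine n then size_biased \<pi> else \<pi>))) (A u))" .
qed

lemma measurable_tree_class_iid_marks [measurable]:
  "(\<lambda>\<xi>. tree_class (marked_tree \<xi> w)) \<in> iid_marks \<pi> \<rightarrow>\<^sub>M borel"
  using measurable_tree_class_marked_tree measurable_cong_sets[OF sets_iid_marks refl] by blast

section \<open>Generation sizes of the Galton-Watson tree\<close>

text \<open>Along the path to \<open>v\<close>, the next letter of \<open>v\<close> is exchanged
  with 0, and nothing else moves; relabelling by it straightens this path into the spine.\<close>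

definition spine_swap :: "nat list \<Rightarrow> nat list \<Rightarrow> nat \<Rightarrow> nat" where
  "spine_swap v u =
     (if length u < length v \<and> u = take (length u) v then Transposition.transpose 0 (v ! length u) else id)"

lemma bij_spine_swap: "bij (spine_swap v u)"
  by (simp add: spine_swap_def)

lemma relabel_spine_swap: "j \<le> length v \<Longrightarrow> relabel (spine_swap v) (take j v) = replicate j 0"
proof (induction j)
  case (Suc j)
  then show ?case
    by (simp add: take_Suc_conv_app_nth spine_swap_def replicate_append_same)
qed simp

text \<open>The marks are transported along the automorphism that straightens the path to
  \<open>v\<close>. Their law is invariant, the tree class is unchanged whenever \<open>v\<close> is
  a vertex, and the marks on the path keep their lengths. The letters of \<open>v\<close> survive on
  the right only as bounds, which prepares the counting of words.\<close>

lemma emeasure_vertex_eq_emeasure_spine: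
  assumes [measurable]: "A \<in> sets borel"
  shows "emeasure (iid_marks \<pi>) {\<xi>. v \<in> marked_tree_verts \<xi> \<and> tree_class (marked_tree \<xi> []) \<in> A} =
    emeasure (iid_marks \<pi>) {\<xi>. (\<forall>j < length v. v ! j < length (\<xi> (replicate j 0))) \<and>
      tree_class (marked_tree \<xi> []) \<in> A}"
    (is "emeasure ?M ?L = emeasure ?M ?R")
proof -
  define \<sigma> where "\<sigma> = relabel (spine_swap v)"
  \<comment> \<open>On the path, \<open>swap_first\<close> replaces the plain transposition: it
    preserves the law of the marks even when a label is missing, and it coincides with the
    transposition when \<open>v\<close> is a vertex.\<close>
  define h where "h u xs = (if length u < length v \<and> u = take (length u) v
    then swap_first (v ! length u) xs else xs)" for u xs
  define \<phi> where "\<phi> \<xi> u = h (inv \<sigma> u) (\<xi> (inv \<sigma> u))" for \<xi> u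
  have \<sigma>: "bij \<sigma>" unfolding \<sigma>_def by (intro bij_relabel bij_spine_swap)
  have \<phi>_\<sigma>: "\<phi> \<xi> (\<sigma> u) = h u (\<xi> u)" for \<xi> u
    using \<sigma> by (simp add: \<phi>_def bij_is_inj)
  have "h u = (if length u < length v \<and> u = take (length u) v then swap_first (v ! length u) else id)" for u
    by (auto simp: h_def fun_eq_iff)
  then have "map_pmf (h u) (uniform_marks \<pi>) = uniform_marks \<pi>" for u
    by (auto simp: map_pmf_swap_first pmf.map_id)
  then have distr: "distr ?M (PiM UNIV (\<lambda>_. count_space UNIV)) \<phi> = ?M"
    unfolding iid_marks_def \<phi>_def
    using distr_PiM_pmf_transform[of "inv \<sigma>" "\<lambda>u. h (inv \<sigma> u)"] \<sigma>
    by (simp add: bij_imp_bij_inv bij_is_inj)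
  have meas: "\<phi> \<in> ?M \<rightarrow>\<^sub>M PiM UNIV (\<lambda>_. count_space UNIV)"
    unfolding \<phi>_def by (rule measurable_PiM_single') auto
  have "{\<xi> \<in> space ?M. (\<forall>j < length v. v ! j < length (\<xi> (replicate j 0))) \<and>
      tree_class (marked_tree \<xi> []) \<in> A} \<in> sets ?M" by measurable
  then have R: "?R \<in> sets ?M" by simp
  have "{\<xi> \<in> space ?M. (\<forall>j < length v. v ! j \<in> set (\<xi> (take j v))) \<and>
      tree_class (marked_tree \<xi> []) \<in> A} \<in> sets ?M" by measurable
  then have L: "?L \<in> sets ?M" by (simp add: marked_tree_verts_iff)
  have AE_set: "AE \<xi> in ?M. \<forall>u. set (\<xi> u) = {..<length (\<xi> u)}"
    unfolding AE_all_countable iid_marks_def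
    by (intro allI AE_PiM_component) (auto simp: prob_space_measure_pmf AE_measure_pmf_iff set_uniform_marks)
  have eq: "\<xi> \<in> ?L \<longleftrightarrow> \<phi> \<xi> \<in> ?R" if set: "\<forall>u. set (\<xi> u) = {..<length (\<xi> u)}" for \<xi>
  proof -
    have "length (\<phi> \<xi> (replicate j 0)) = length (\<xi> (take j v))" if "j < length v" for j
      using \<phi>_\<sigma>[of \<xi> "take j v"] relabel_spine_swap[of j v] that by (simp add: \<sigma>_def h_def)
    then have verts: "v \<in> marked_tree_verts \<xi> \<longleftrightarrow> (\<forall>j < length v. v ! j < length (\<phi> \<xi> (replicate j 0)))"
      using set by (simp add: marked_tree_verts_iff)
    \<comment> \<open>By \<open>verts\<close>, both events fail if \<open>v\<close> is not a vertex,
      so the classes need to be compared only otherwise.\<close>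
    have "tree_class (marked_tree \<xi> []) = tree_class (marked_tree (\<phi> \<xi>) [])" if v: "v \<in> marked_tree_verts \<xi>"
    proof (intro tree_class_eqI family_tree_marked_tree marked_tree_verts.intros)
      have "\<phi> \<xi> (relabel (spine_swap v) u) = map (spine_swap v u) (\<xi> u)" for u
      proof (cases "length u < length v \<and> u = take (length u) v")
        case True
        have "v ! length u \<in> set (\<xi> (take (length u) v))"
          using v conjunct1[OF True] unfolding marked_tree_verts_iff by blast
        then have "v ! length u \<in> set (\<xi> u)" unfolding conjunct2[OF True, symmetric] .
        \<comment> \<open>The mark is nonempty and its labels form an initial segment, so 0 occurs
          as well.\<close>
        then have "{0, v ! length u} \<subseteq> set (\<xi> u)" using set by auto
        then have "swap_first (v ! length u) (\<xi> u) = map (spine_swap v u) (\<xi> u)"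
          unfolding swap_first_def spine_swap_def if_P[OF True] by (rule if_P)
        then show ?thesis using \<phi>_\<sigma>[of \<xi> u] unfolding \<sigma>_def h_def if_P[OF True] by simp
      next
        case False
        have "h u (\<xi> u) = \<xi> u" "spine_swap v u = id"
          unfolding h_def spine_swap_def if_not_P[OF False] by (rule refl)+
        then show ?thesis using \<phi>_\<sigma>[of \<xi> u] by (simp add: \<sigma>_def)
      qed
      then show "isomorphic (marked_tree \<xi> []) (marked_tree (\<phi> \<xi>) [])"
        by (rule isomorphic_relabel[OF bij_spine_swap])
    qed
    then show ?thesis using verts by auto
  qed
  have "emeasure ?M ?R = emeasure (distr ?M (PiM UNIV (\<lambda>_. count_space UNIV)) \<phi>) ?R"
    by (simp only: distr)
  also have "\<dots> = emeasure ?M (\<phi> -` ?R \<inter> space ?M)"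
    using meas R by (intro emeasure_distr) (simp_all add: sets_iid_marks)
  also have "\<dots> = emeasure ?M ?L"
  proof (rule emeasure_eq_AE)
    show "AE \<xi> in ?M. (\<xi> \<in> \<phi> -` ?R \<inter> space ?M) = (\<xi> \<in> ?L)"
      using AE_set by (rule AE_mp) (auto intro!: AE_I2 dest: eq)
    show "\<phi> -` ?R \<inter> space ?M \<in> sets ?M"
      using meas R by (intro measurable_sets) (simp_all add: sets_iid_marks)
  qed (rule L)
  finally show ?thesis ..
qed

lemma finite_bounded_words: "finite {v. length v = n \<and> (\<forall>j < n. v ! j < (l j :: nat))}"
  and card_bounded_words: "card {v. length v = n \<and> (\<forall>j < n. v ! j < l j)} = (\<Prod>j < n. l j)"
proof (induction n)
  case (Suc n)
  let ?W = "\<lambda>n. {v. length v = n \<and> (\<forall>j < n. v ! j < l j)}"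
  have eq: "?W (Suc n) = (\<lambda>(v, i). v @ [i]) ` (?W n \<times> {..<l n})"
  proof (intro set_eqI iffI)
    fix v assume v: "v \<in> ?W (Suc n)"
    then have "v = butlast v @ [last v]" by (cases v rule: rev_cases) auto
    moreover have "butlast v \<in> ?W n" "last v < l n"
      using v last_conv_nth[of v] by (auto simp: nth_butlast simp flip: length_greater_0_conv)
    ultimately show "v \<in> (\<lambda>(v, i). v @ [i]) ` (?W n \<times> {..<l n})"
      by (auto intro!: image_eqI[where x = "(butlast v, last v)"])
  qed (auto simp: nth_append less_Suc_eq)
  { case 1 show ?case unfolding eq using Suc by auto }
  { case 2
    have "inj_on (\<lambda>(v, i). v @ [i]) (?W n \<times> {..<l n})" by (auto simp: inj_on_def)
    then show ?case unfolding eq using Suc by (simp add: card_image card_cartesian_product) }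
qed simp_all

lemma emeasure_bounded_words:
  "emeasure (count_space UNIV) {v. \<forall>j < length v. v ! j < (l j :: nat)} =
    (\<Sum>n. \<Prod>j < n. ennreal (real (l j)))"
proof -
  let ?W = "\<lambda>n. {v. length v = n \<and> (\<forall>j < n. v ! j < l j)}"
  have "emeasure (count_space UNIV) (?W n) = (\<Prod>j < n. ennreal (real (l j)))" for n
    using finite_bounded_words[of n l]
    by (simp add: emeasure_count_space card_bounded_words ennreal_of_nat_eq_real_of_nat prod_ennreal)
  moreover have "(\<Sum>n. emeasure (count_space UNIV) (?W n)) = emeasure (count_space UNIV) (\<Union>n. ?W n)"
    by (intro suminf_emeasure) (auto simp: disjoint_family_on_def)
  moreover have "(\<Union>n. ?W n) = {v. \<forall>j < length v. v ! j < l j}" by auto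
  ultimately show ?thesis by simp
qed

text \<open>A many-to-one formula: the size is a sum of indicators over the countably many words, so
  Tonelli isolates one word at a time, where labels can be exchanged. Tonelli backwards then leaves,
  for each generation, a product of mark lengths on the spine.\<close>

lemma nn_integral_num_verts_GW:
  assumes [measurable]: "A \<in> sets borel" and pos: "0 < mean \<pi>"
  shows "(\<integral>\<^sup>+ t. num_verts t * indicator A t \<partial>GW \<pi>) =
    (\<Sum>n. ennreal (mean \<pi> ^ n) * emeasure (spine_law \<pi> n) {\<xi>. tree_class (marked_tree \<xi> []) \<in> A})"
proof -
  let ?M = "iid_marks \<pi>" and ?T = "\<lambda>\<xi>. tree_class (marked_tree \<xi> [])"
  let ?P = "\<lambda>v \<xi>. \<forall>j < length v. v ! j < length (\<xi> (replicate j 0 :: nat list) :: nat list)"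
  have "{\<xi> \<in> space ?M. ?T \<xi> \<in> A} \<in> sets ?M" by measurable
  then have TA: "{\<xi>. ?T \<xi> \<in> A} \<in> sets ?M" by simp
  have "{\<xi> \<in> space ?M. ?P v \<xi> \<and> ?T \<xi> \<in> A} \<in> sets ?M" for v by measurable
  then have R: "{\<xi>. ?P v \<xi> \<and> ?T \<xi> \<in> A} \<in> sets ?M" for v by simp
  have "{\<xi> \<in> space ?M. (\<forall>j < length v. v ! j \<in> set (\<xi> (take j v))) \<and> ?T \<xi> \<in> A} \<in> sets ?M" for v
    by measurable
  then have L: "{\<xi>. v \<in> marked_tree_verts \<xi> \<and> ?T \<xi> \<in> A} \<in> sets ?M" for v
    by (simp add: marked_tree_verts_iff)
  have num: "num_verts (?T \<xi>) = emeasure (count_space UNIV) (marked_tree_verts \<xi>)" for \<xi>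
    using family_tree_marked_tree[OF marked_tree_verts.intros(1)]
    by (subst num_verts.abs_eq) (auto simp: family_tree_eq_def isomorphic_refl)
  have "(\<integral>\<^sup>+ t. num_verts t * indicator A t \<partial>GW \<pi>) = (\<integral>\<^sup>+ \<xi>. num_verts (?T \<xi>) * indicator A (?T \<xi>) \<partial>?M)"
    unfolding GW_def by (subst nn_integral_distr) auto
  also have "\<dots> = (\<integral>\<^sup>+ \<xi>. \<integral>\<^sup>+ v. indicator {\<xi>. v \<in> marked_tree_verts \<xi> \<and> ?T \<xi> \<in> A} \<xi> \<partial>count_space UNIV \<partial>?M)"
  proof (intro nn_integral_cong)
    fix \<xi>
    have "num_verts (?T \<xi>) * indicator A (?T \<xi>) =
        (\<integral>\<^sup>+ v. indicator (marked_tree_verts \<xi>) v * indicator A (?T \<xi>) \<partial>count_space UNIV)"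
      by (subst nn_integral_multc) (simp_all add: num)
    also have "\<dots> = (\<integral>\<^sup>+ v. indicator {\<xi>. v \<in> marked_tree_verts \<xi> \<and> ?T \<xi> \<in> A} \<xi> \<partial>count_space UNIV)"
      by (intro nn_integral_cong) (auto simp: indicator_def)
    finally show "num_verts (?T \<xi>) * indicator A (?T \<xi>) =
        (\<integral>\<^sup>+ v. indicator {\<xi>. v \<in> marked_tree_verts \<xi> \<and> ?T \<xi> \<in> A} \<xi> \<partial>count_space UNIV)" .
  qed
  also have "\<dots> = (\<integral>\<^sup>+ v. emeasure ?M {\<xi>. v \<in> marked_tree_verts \<xi> \<and> ?T \<xi> \<in> A} \<partial>count_space UNIV)"
    using L by (subst nn_integral_count_space_nn_integral) auto
  also have "\<dots> = (\<integral>\<^sup>+ v. emeasure ?M {\<xi>. ?P v \<xi> \<and> ?T \<xi> \<in> A} \<partial>count_space UNIV)"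
    by (simp add: emeasure_vertex_eq_emeasure_spine)
  also have "\<dots> = (\<integral>\<^sup>+ \<xi>. \<integral>\<^sup>+ v. indicator {\<xi>. ?P v \<xi> \<and> ?T \<xi> \<in> A} \<xi> \<partial>count_space UNIV \<partial>?M)"
    using R by (subst nn_integral_count_space_nn_integral) auto
  also have "\<dots> = (\<integral>\<^sup>+ \<xi>. (\<Sum>n. ennreal (mean \<pi> ^ n) *
      ((\<Prod>u \<in> spine n. ennreal (real (length (\<xi> u)) / mean \<pi>)) * indicator {\<xi>. ?T \<xi> \<in> A} \<xi>)) \<partial>?M)"
  proof (intro nn_integral_cong)
    fix \<xi> :: "nat list \<Rightarrow> nat list"
    \<comment> \<open>Normalising each of the n lengths by the mean produces the density of
      \<open>spine_law \<pi> n\<close> and leaves the factor \<open>mean \<pi> ^ n\<close>.\<close>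
    have factor: "(\<Prod>j < n. ennreal (real (length (\<xi> (replicate j 0))))) =
        ennreal (mean \<pi> ^ n) * (\<Prod>u \<in> spine n. ennreal (real (length (\<xi> u)) / mean \<pi>))" for n
    proof -
      have "inj_on (\<lambda>j. replicate j (0::nat)) {..<n}" by (auto simp: inj_on_def)
      then have "(\<Prod>u \<in> spine n. ennreal (real (length (\<xi> u)) / mean \<pi>)) =
          (\<Prod>j < n. ennreal (real (length (\<xi> (replicate j 0))) / mean \<pi>))"
        unfolding spine_def by (simp add: prod.reindex)
      moreover have "ennreal (mean \<pi> ^ n) = (\<Prod>j < n. ennreal (mean \<pi>))"
        using pos by (simp add: ennreal_power)
      moreover have "ennreal (mean \<pi>) * ennreal (real k / mean \<pi>) = ennreal (real k)" for k
        using pos by (simp add: ennreal_mult[symmetric])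
      ultimately show ?thesis by (simp only: prod.distrib[symmetric])
    qed
    have "(\<integral>\<^sup>+ v. indicator {\<xi>. ?P v \<xi> \<and> ?T \<xi> \<in> A} \<xi> \<partial>count_space UNIV) =
        (\<integral>\<^sup>+ v. indicator {v. ?P v \<xi>} v * indicator {\<xi>. ?T \<xi> \<in> A} \<xi> \<partial>count_space UNIV)"
      by (intro nn_integral_cong) (auto simp: indicator_def)
    also have "\<dots> = emeasure (count_space UNIV) {v. ?P v \<xi>} * indicator {\<xi>. ?T \<xi> \<in> A} \<xi>"
      by (subst nn_integral_multc) simp_all
    also have "\<dots> = (\<Sum>n. (\<Prod>j < n. ennreal (real (length (\<xi> (replicate j 0))))) * indicator {\<xi>. ?T \<xi> \<in> A} \<xi>)"
      by (simp only: emeasure_bounded_words ennreal_suminf_multc)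
    finally show "(\<integral>\<^sup>+ v. indicator {\<xi>. ?P v \<xi> \<and> ?T \<xi> \<in> A} \<xi> \<partial>count_space UNIV) =
        (\<Sum>n. ennreal (mean \<pi> ^ n) *
          ((\<Prod>u \<in> spine n. ennreal (real (length (\<xi> u)) / mean \<pi>)) * indicator {\<xi>. ?T \<xi> \<in> A} \<xi>))"
      by (simp only: factor mult.assoc)
  qed
  also have "\<dots> = (\<Sum>n. ennreal (mean \<pi> ^ n) * (\<integral>\<^sup>+ \<xi>.
      (\<Prod>u \<in> spine n. ennreal (real (length (\<xi> u)) / mean \<pi>)) * indicator {\<xi>. ?T \<xi> \<in> A} \<xi> \<partial>?M))"
    using TA by (simp add: nn_integral_suminf nn_integral_cmult)
  also have "\<dots> = (\<Sum>n. ennreal (mean \<pi> ^ n) * emeasure (spine_law \<pi> n) {\<xi>. ?T \<xi> \<in> A})"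
    using TA by (simp add: density_spine_law[OF pos, symmetric] emeasure_density measurable_spine_density)
  finally show ?thesis .
qed

section \<open>The typically rooted tree seen from its oldest ancestor\<close>

abbreviation TGWT_marks :: "nat pmf \<Rightarrow> (nat \<times> (nat \<Rightarrow> nat list) \<times> (nat list \<Rightarrow> nat list)) measure" where
  "TGWT_marks \<pi> \<equiv> measure_pmf (geometric_pmf (1 - mean \<pi>)) \<Otimes>\<^sub>M (iid_marks (size_biased \<pi>) \<Otimes>\<^sub>M iid_marks \<pi>)"

lemma prob_space_TGWT_marks: "prob_space (TGWT_marks \<pi>)"
  by (intro prob_space_pair prob_space_measure_pmf prob_space_iid_marks)

text \<open>The number of ancestors is discrete, so it may be fixed. The parameter \<open>w\<close>
  serves both rootings: at the typical vertex and at its oldest ancestor.\<close>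

lemma measurable_spine_tree [measurable]:
  "(\<lambda>(n, \<zeta>, \<xi>). tree_class (marked_tree (spine_marks n \<zeta> \<xi>) (w n))) \<in> TGWT_marks \<pi> \<rightarrow>\<^sub>M borel"
proof -
  have "(\<lambda>(n, \<zeta>, \<xi>). tree_class (marked_tree (spine_marks n \<zeta> \<xi>) (w n))) \<in>
      count_space UNIV \<Otimes>\<^sub>M (iid_marks (size_biased \<pi>) \<Otimes>\<^sub>M iid_marks \<pi>) \<rightarrow>\<^sub>M borel"
  proof (rule measurable_pair_measure_countable1)
    fix n
    show "(\<lambda>y. case (n, y) of (n, \<zeta>, \<xi>) \<Rightarrow> tree_class (marked_tree (spine_marks n \<zeta> \<xi>) (w n))) \<in>
        iid_marks (size_biased \<pi>) \<Otimes>\<^sub>M iid_marks \<pi> \<rightarrow>\<^sub>M borel"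
      using measurable_compose[OF measurable_spine_marks[of n] measurable_tree_class_marked_tree[of "w n"]]
      by (simp add: split_beta)
  qed simp
  moreover have "sets (TGWT_marks \<pi>) = sets (count_space UNIV \<Otimes>\<^sub>M (iid_marks (size_biased \<pi>) \<Otimes>\<^sub>M iid_marks \<pi>))"
    by (rule sets_pair_measure_cong) auto
  ultimately show ?thesis using measurable_cong_sets by blast
qed

lemma distr_oldest_ancestor_eq_SBGW:
  assumes m: "0 < mean \<pi>" "mean \<pi> < 1"
  shows "distr (TGWT_marks \<pi>) borel (\<lambda>(n, \<zeta>, \<xi>). tree_class (marked_tree (spine_marks n \<zeta> \<xi>) [])) = SBGW \<pi>"
    (is "distr ?M borel ?F = _")
proof -
  let ?P = "iid_marks (size_biased \<pi>) \<Otimes>\<^sub>M iid_marks \<pi>" and ?E = "\<integral>\<^sup>+ t. num_verts t \<partial>GW \<pi>"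
  interpret M: prob_space ?M by (rule prob_space_TGWT_marks)
  interpret P: prob_space ?P by (intro prob_space_pair prob_space_iid_marks)
  have sets_GW [simp, measurable_cong]: "sets (GW \<pi>) = sets borel" by (simp add: GW_def)
  have F [measurable]: "?F \<in> ?M \<rightarrow>\<^sub>M borel" by (rule measurable_spine_tree)
  have em: "emeasure (distr ?M borel ?F) A = ennreal (1 - mean \<pi>) * (\<integral>\<^sup>+ t. num_verts t * indicator A t \<partial>GW \<pi>)"
    if A [measurable]: "A \<in> sets borel" for A
  proof -
    have "emeasure (distr ?M borel ?F) A = emeasure ?M (?F -` A \<inter> space ?M)"
      by (simp add: emeasure_distr)
    also have "\<dots> = (\<integral>\<^sup>+ n. emeasure ?P (Pair n -` (?F -` A \<inter> space ?M)) \<partial>measure_pmf (geometric_pmf (1 - mean \<pi>)))"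
      by (intro P.emeasure_pair_measure_alt) measurable
    also have "\<dots> = (\<integral>\<^sup>+ n. emeasure (spine_law \<pi> n) {\<xi>. tree_class (marked_tree \<xi> []) \<in> A}
        \<partial>measure_pmf (geometric_pmf (1 - mean \<pi>)))"
    proof (intro nn_integral_cong)
      fix n
      have "{\<xi>. tree_class (marked_tree \<xi> []) \<in> A} \<in> sets (PiM UNIV (\<lambda>_. count_space UNIV))"
        using measurable_sets[OF measurable_tree_class_marked_tree A] by (simp add: vimage_def space_PiM)
      moreover have "Pair n -` (?F -` A \<inter> space ?M) =
          (\<lambda>(\<zeta>, \<xi>). spine_marks n \<zeta> \<xi>) -` {\<xi>. tree_class (marked_tree \<xi> []) \<in> A} \<inter> space ?P"
        by (auto simp: space_pair_measure)
      ultimately show "emeasure ?P (Pair n -` (?F -` A \<inter> space ?M)) =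
          emeasure (spine_law \<pi> n) {\<xi>. tree_class (marked_tree \<xi> []) \<in> A}"
        unfolding distr_spine_marks[symmetric] by (simp add: emeasure_distr[OF measurable_spine_marks])
    qed
    also have "\<dots> = (\<Sum>n. ennreal (1 - mean \<pi>) * (ennreal (mean \<pi> ^ n) *
        emeasure (spine_law \<pi> n) {\<xi>. tree_class (marked_tree \<xi> []) \<in> A}))"
      using m by (simp add: nn_integral_measure_pmf nn_integral_count_space_nat ennreal_mult ac_simps)
    also have "\<dots> = ennreal (1 - mean \<pi>) * (\<integral>\<^sup>+ t. num_verts t * indicator A t \<partial>GW \<pi>)"
      using nn_integral_num_verts_GW[OF A m(1)] by simp
    finally show ?thesis .
  qed
  \<comment> \<open>Taking the whole space for \<open>A\<close> shows that the expected size is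
    finite and is the reciprocal of \<open>1 - mean \<pi>\<close>, which is the normalising constant
    of \<open>SBGW\<close>.\<close>
  have "1 = ennreal (1 - mean \<pi>) * ?E"
    using em[of UNIV] prob_space.emeasure_space_1[OF M.prob_space_distr[OF F]] by simp
  then have E: "1 / ?E = ennreal (1 - mean \<pi>)"
    using m by (metis ennreal_divide_times ennreal_mult_divide_eq ennreal_top_mult mult.commute mult_1 mult_zero_right zero_neq_one top_neq_ennreal)
  show ?thesis
  proof (rule measure_eqI)
    fix A assume "A \<in> sets (distr ?M borel ?F)"
    then have A [measurable]: "A \<in> sets borel" by simp
    show "emeasure (distr ?M borel ?F) A = emeasure (SBGW \<pi>) A"
      unfolding SBGW_def E em[OF A] by (simp add: emeasure_density)
  qed (simp add: SBGW_def)
qed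

lemma parent_of_marked_tree:
  assumes "v \<in> marked_tree_verts \<xi>"
  shows "parent_of (marked_tree \<xi> w) v = butlast v"
proof (cases v rule: rev_cases)
  case Nil
  then show ?thesis by (simp add: parent_of_def)
next
  case (snoc u i)
  then show ?thesis using assms by (simp add: parent_of_def marked_tree_verts_snoc)
qed

text \<open>Truncated subtraction matches the convention that F fixes a vertex without parent: once
  \<open>n\<close> reaches \<open>length w\<close>, the root stays at the empty word.\<close>

lemma ancestor_shift_marked_tree:
  assumes "w \<in> marked_tree_verts \<xi>"
  shows "ancestor_shift n (tree_class (marked_tree \<xi> w)) =
    tree_class (marked_tree \<xi> (take (length w - n) w))"
proof -
  let ?T = "marked_tree \<xi> w"
  have "(parent_of ?T ^^ n) w = take (length w - n) w"
  proof (induction n)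
    case (Suc n)
    then show ?case using assms
      by (simp add: parent_of_marked_tree marked_tree_verts_take butlast_take)
  qed simp
  then have "reroot ((parent_of ?T ^^ n) (root ?T)) ?T = marked_tree \<xi> (take (length w - n) w)"
    by (simp add: reroot_def marked_tree_def)
  moreover have "family_tree_eq ?T ?T"
    using assms by (simp add: family_tree_eq_def family_tree_marked_tree isomorphic_refl)
  ultimately show ?thesis by (simp only: ancestor_shift.abs_eq)
qed

text \<open>Size-biasing gives weight 0 to childlessness, so almost surely every spine mark is
  nonempty and contains the label 0. Without this the chosen root could fall outside the tree and
  the class would be junk.\<close>

lemma AE_spine_in_verts:
  assumes "0 < mean \<pi>"
  shows "AE (n, \<zeta>, \<xi>) in TGWT_marks \<pi>. replicate n 0 \<in> marked_tree_verts (spine_marks n \<zeta> \<xi>)"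
proof -
  let ?P = "iid_marks (size_biased \<pi>) :: (nat \<Rightarrow> nat list) measure"
  interpret P: prob_space ?P by (rule prob_space_iid_marks)
  interpret Q: prob_space "iid_marks \<pi>" by (rule prob_space_iid_marks)
  interpret PQ: pair_prob_space ?P "iid_marks \<pi>" ..
  interpret GPQ: pair_prob_space "measure_pmf (geometric_pmf (1 - mean \<pi>))" "?P \<Otimes>\<^sub>M iid_marks \<pi>" ..
  have zero: "0 \<in> set xs" if "xs \<in> set_pmf (uniform_marks (size_biased \<pi>))" for xs
  proof -
    have "xs \<noteq> []"
      using that assms by (auto simp: set_pmf_iff pmf_uniform_marks pmf_size_biased)
    then show ?thesis using set_uniform_marks[OF that] by simp
  qed
  have AE_zero: "AE \<zeta> in ?P. \<forall>k. 0 \<in> set (\<zeta> k)"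
    unfolding AE_all_countable iid_marks_def
    by (intro allI AE_PiM_component) (auto simp: prob_space_measure_pmf AE_measure_pmf_iff zero)
  have "AE y in ?P \<Otimes>\<^sub>M iid_marks \<pi>. \<forall>k. 0 \<in> set (fst y k)"
  proof (rule PQ.AE_pair_measure)
    show "{y \<in> space (?P \<Otimes>\<^sub>M iid_marks \<pi>). \<forall>k. 0 \<in> set (fst y k)} \<in> sets (?P \<Otimes>\<^sub>M iid_marks \<pi>)"
      by measurable
    show "AE \<zeta> in ?P. AE \<xi> in iid_marks \<pi>. \<forall>k. 0 \<in> set (fst (\<zeta>, \<xi>) k)"
      using AE_zero by (rule AE_mp) simp
  qed
  then have "AE x in TGWT_marks \<pi>. \<forall>k. 0 \<in> set (fst (snd x) k)"
    by (intro GPQ.AE_pair_measure) simp_all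
  then show ?thesis
  proof (rule AE_mp, intro AE_I2 impI)
    fix x :: "nat \<times> (nat \<Rightarrow> nat list) \<times> (nat list \<Rightarrow> nat list)"
    assume "\<forall>k. 0 \<in> set (fst (snd x) k)"
    then show "case x of (n, \<zeta>, \<xi>) \<Rightarrow> replicate n 0 \<in> marked_tree_verts (spine_marks n \<zeta> \<xi>)"
      by (auto simp: marked_tree_verts_iff spine_marks_eq spine_def split: prod.splits)
  qed
qed

theorem proposition78:
  fixes \<pi> :: "nat pmf"
  assumes "0 < mean \<pi>" and "mean \<pi> < 1"
  shows "is_parent_shift_probability (TGWT \<pi>) (SBGW \<pi>)"
proof -
  let ?M = "TGWT_marks \<pi>"
  let ?F = "\<lambda>w (n, \<zeta>, \<xi>). tree_class (marked_tree (spine_marks n \<zeta> \<xi>) (w n))"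
  let ?o = "\<lambda>n. replicate n (0::nat)"
  interpret M: prob_space ?M by (rule prob_space_TGWT_marks)
  have F: "?F w \<in> ?M \<rightarrow>\<^sub>M borel" for w by (rule measurable_spine_tree)
  have T: "TGWT \<pi> = distr ?M borel (?F ?o)" by (simp add: TGWT_def)
  have S: "SBGW \<pi> = distr ?M borel (?F (\<lambda>_. []))"
    using distr_oldest_ancestor_eq_SBGW[OF assms] by simp
  \<comment> \<open>All laws are written as images of the single measure
    \<open>TGWT_marks \<pi>\<close>, a coupling under which almost sure convergence can be
    used.\<close>
  have shift: "distr (TGWT \<pi>) borel (ancestor_shift i) = distr ?M borel (\<lambda>x. ancestor_shift i (?F ?o x))" for i
    unfolding T by (subst distr_distr[OF measurable_ancestor_shift F]) (simp add: comp_def)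
  have shift_meas: "(\<lambda>x. ancestor_shift i (?F ?o x)) \<in> ?M \<rightarrow>\<^sub>M borel" for i
    using F[of ?o] measurable_ancestor_shift by (rule measurable_compose)
  have "(\<lambda>i. \<integral>t. f t \<partial>distr (TGWT \<pi>) borel (ancestor_shift i)) \<longlonglongrightarrow> (\<integral>t. f t \<partial>SBGW \<pi>)"
    if f: "continuous_on UNIV f" "bounded (range f)" for f :: "family_tree \<Rightarrow> real"
  proof -
    obtain B where B: "\<And>t. norm (f t) \<le> B" using f(2) by (auto simp: bounded_iff)
    have f_meas: "f \<in> borel_measurable borel" using f(1) by (rule borel_measurable_continuous_onI)
    have "(\<lambda>i. \<integral>x. f (ancestor_shift i (?F ?o x)) \<partial>?M) \<longlonglongrightarrow> (\<integral>x. f (?F (\<lambda>_. []) x) \<partial>?M)"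
    proof (rule integral_dominated_convergence[where w = "\<lambda>_. B"])
      show "(\<lambda>x. f (?F (\<lambda>_. []) x)) \<in> borel_measurable ?M"
        using F f_meas by (rule measurable_compose)
      show "(\<lambda>x. f (ancestor_shift i (?F ?o x))) \<in> borel_measurable ?M" for i
        using shift_meas f_meas by (rule measurable_compose)
      show "AE x in ?M. (\<lambda>i. f (ancestor_shift i (?F ?o x))) \<longlonglongrightarrow> f (?F (\<lambda>_. []) x)"
        using AE_spine_in_verts[OF assms(1)]
      proof (rule AE_mp, intro AE_I2 impI)
        fix x assume "case x of (n, \<zeta>, \<xi>) \<Rightarrow> replicate n 0 \<in> marked_tree_verts (spine_marks n \<zeta> \<xi>)"
        \<comment> \<open>\<open>fst x\<close> is the number of ancestors; from that index on, the
          sequence is constant and equal to the tree rooted at its oldest ancestor.\<close>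
        then have eq: "ancestor_shift i (?F ?o x) = ?F (\<lambda>_. []) x" if "fst x \<le> i" for i
          using that by (auto simp: ancestor_shift_marked_tree split: prod.splits)
        show "(\<lambda>i. f (ancestor_shift i (?F ?o x))) \<longlonglongrightarrow> f (?F (\<lambda>_. []) x)"
          by (intro tendsto_eventually eventually_sequentiallyI[of "fst x"] arg_cong[where f = f] eq)
      qed
    qed (use B in auto)
    then show ?thesis
      unfolding shift S by (simp only: integral_distr[OF shift_meas f_meas] integral_distr[OF F f_meas])
  qed
  then show ?thesis
    unfolding is_parent_shift_probability_def weakly_converges_to_def
    by (simp add: shift S M.prob_space_distr[OF shift_meas] M.prob_space_distr[OF F])
qed

end
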